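(* Let $R$ be a local ring (that is, a ring where the non-units form a two-sided ideal). An $R$-module $M$ is a flat strict Mittag-Leffler module if and only if it equals the direct limit of its finite free direct summands.
   Context: $R$ is an associative ring with unit; "$R$-module" means left $R$-module. A finite free direct summand of $M$ is a submodule of $M$ that is free of finite rank and a direct summand of $M$; "$M$ equals the direct limit of its finite free direct summands" means that the set of these submodules is upward directed by inclusion and $M$ is its union. $M$ is a flat strict Mittag-Leffler module if and only if, with $M^*=\mathrm{Hom}_R(M,R)$ (a right $R$-module), the natural map $N\otimes_RM\to\mathrm{Hom}_R(M^*,N)$, $n\otimes m\mapsto(w\mapsto n\cdot w(m))$, is injective for every right $R$-module $N$ (this characterization is used as the definition). *)

theory Defs
  imports "HOL-Algebra.Algebra"
begin

text \<open>
  Rings need not be commutative, so the locale \<open>module\<close> of the library, which requires a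
  commutative ring, cannot be used. Only its record type is reused; as for \<open>module\<close>, the
  fields \<open>mult\<close> and \<open>one\<close> of a module record are irrelevant.
\<close>

locale left_module = R?: ring R + M?: abelian_group M for R :: "('r, 'k) ring_scheme" (structure) and M :: "('r, 'm, 'l) module_scheme" (structure) +
  assumes smult_closed [simp, intro]:
      "\<lbrakk>a \<in> carrier R; x \<in> carrier M\<rbrakk> \<Longrightarrow> a \<odot>\<^bsub>M\<^esub> x \<in> carrier M"
    and smult_l_distr:
      "\<lbrakk>a \<in> carrier R; b \<in> carrier R; x \<in> carrier M\<rbrakk> \<Longrightarrow>
      (a \<oplus>\<^bsub>R\<^esub> b) \<odot>\<^bsub>M\<^esub> x = a \<odot>\<^bsub>M\<^esub> x \<oplus>\<^bsub>M\<^esub> b \<odot>\<^bsub>M\<^esub> x"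
    and smult_r_distr:
      "\<lbrakk>a \<in> carrier R; x \<in> carrier M; y \<in> carrier M\<rbrakk> \<Longrightarrow>
      a \<odot>\<^bsub>M\<^esub> (x \<oplus>\<^bsub>M\<^esub> y) = a \<odot>\<^bsub>M\<^esub> x \<oplus>\<^bsub>M\<^esub> a \<odot>\<^bsub>M\<^esub> y"
    and smult_assoc:
      "\<lbrakk>a \<in> carrier R; b \<in> carrier R; x \<in> carrier M\<rbrakk> \<Longrightarrow>
      (a \<otimes>\<^bsub>R\<^esub> b) \<odot>\<^bsub>M\<^esub> x = a \<odot>\<^bsub>M\<^esub> (b \<odot>\<^bsub>M\<^esub> x)"
    and smult_one [simp]:
      "x \<in> carrier M \<Longrightarrow> \<one>\<^bsub>R\<^esub> \<odot>\<^bsub>M\<^esub> x = x"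

text \<open>For a right module, \<open>a \<odot>\<^bsub>N\<^esub> x\<close> stands for \<open>x \<cdot> a\<close>.\<close>

locale right_module = R?: ring R + N?: abelian_group N for R :: "('r, 'k) ring_scheme" (structure) and N :: "('r, 'n, 'j) module_scheme" (structure) +
  assumes smult_closed [simp, intro]:
      "\<lbrakk>a \<in> carrier R; x \<in> carrier N\<rbrakk> \<Longrightarrow> a \<odot>\<^bsub>N\<^esub> x \<in> carrier N"
    and smult_l_distr:
      "\<lbrakk>a \<in> carrier R; b \<in> carrier R; x \<in> carrier N\<rbrakk> \<Longrightarrow>
      (a \<oplus>\<^bsub>R\<^esub> b) \<odot>\<^bsub>N\<^esub> x = a \<odot>\<^bsub>N\<^esub> x \<oplus>\<^bsub>N\<^esub> b \<odot>\<^bsub>N\<^esub> x"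
    and smult_r_distr:
      "\<lbrakk>a \<in> carrier R; x \<in> carrier N; y \<in> carrier N\<rbrakk> \<Longrightarrow>
      a \<odot>\<^bsub>N\<^esub> (x \<oplus>\<^bsub>N\<^esub> y) = a \<odot>\<^bsub>N\<^esub> x \<oplus>\<^bsub>N\<^esub> a \<odot>\<^bsub>N\<^esub> y"
    and smult_assoc:
      "\<lbrakk>a \<in> carrier R; b \<in> carrier R; x \<in> carrier N\<rbrakk> \<Longrightarrow>
      (a \<otimes>\<^bsub>R\<^esub> b) \<odot>\<^bsub>N\<^esub> x = b \<odot>\<^bsub>N\<^esub> (a \<odot>\<^bsub>N\<^esub> x)"
    and smult_one [simp]:
      "x \<in> carrier N \<Longrightarrow> \<one>\<^bsub>R\<^esub> \<odot>\<^bsub>N\<^esub> x = x"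

text \<open>The locale \<open>ideal\<close> means two-sided ideal, and elements of \<open>Units R\<close> are invertible on both
  sides. The zero ring is excluded, as its set of non-units is empty.\<close>

definition local_ring :: "('r, 'k) ring_scheme \<Rightarrow> bool" where
  "local_ring R \<longleftrightarrow> ring R \<and> ideal (carrier R - Units R) R"

definition dual :: "('r, 'k) ring_scheme \<Rightarrow> ('r, 'm, 'l) module_scheme \<Rightarrow> ('r, 'm \<Rightarrow> 'r) module" where
  "dual R M =
    \<lparr>carrier = {w \<in> carrier M \<rightarrow>\<^sub>E carrier R.
        (\<forall>x\<in>carrier M. \<forall>y\<in>carrier M. w (x \<oplus>\<^bsub>M\<^esub> y) = w x \<oplus>\<^bsub>R\<^esub> w y) \<and>
        (\<forall>a\<in>carrier R. \<forall>x\<in>carrier M. w (a \<odot>\<^bsub>M\<^esub> x) = a \<otimes>\<^bsub>R\<^esub> w x)},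
     monoid.mult = undefined, one = undefined,
     ring.zero = (\<lambda>x\<in>carrier M. \<zero>\<^bsub>R\<^esub>),
     add = (\<lambda>v w. \<lambda>x\<in>carrier M. v x \<oplus>\<^bsub>R\<^esub> w x),
     smult = (\<lambda>a w. \<lambda>x\<in>carrier M. w x \<otimes>\<^bsub>R\<^esub> a)\<rparr>"

definition right_hom_group ::
  "('r, 'k) ring_scheme \<Rightarrow> ('r, 'p, 'i) module_scheme \<Rightarrow> ('r, 'n, 'j) module_scheme \<Rightarrow> ('p \<Rightarrow> 'n) monoid" where
  "right_hom_group R P N =
    \<lparr>carrier = {f \<in> carrier P \<rightarrow>\<^sub>E carrier N.
        (\<forall>x\<in>carrier P. \<forall>y\<in>carrier P. f (x \<oplus>\<^bsub>P\<^esub> y) = f x \<oplus>\<^bsub>N\<^esub> f y) \<and>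
        (\<forall>a\<in>carrier R. \<forall>x\<in>carrier P. f (a \<odot>\<^bsub>P\<^esub> x) = a \<odot>\<^bsub>N\<^esub> f x)},
     monoid.mult = (\<lambda>f g. \<lambda>x\<in>carrier P. f x \<oplus>\<^bsub>N\<^esub> g x),
     one = (\<lambda>x\<in>carrier P. \<zero>\<^bsub>N\<^esub>)\<rparr>"

text \<open>The tensor product of a right module \<open>N\<close> and a left module \<open>M\<close>: the free abelian group on
  pairs modulo the usual relations, in which \<open>a \<odot>\<^bsub>N\<^esub> n\<close> is \<open>n \<cdot> a\<close>.\<close>

definition tensor_rels ::
  "('r, 'k) ring_scheme \<Rightarrow> ('r, 'n, 'j) module_scheme \<Rightarrow> ('r, 'm, 'l) module_scheme \<Rightarrow> ('n \<times> 'm \<Rightarrow>\<^sub>0 int) set" where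
  "tensor_rels R N M =
    {frag_of (n \<oplus>\<^bsub>N\<^esub> n', m) - frag_of (n, m) - frag_of (n', m) | n n' m.
        n \<in> carrier N \<and> n' \<in> carrier N \<and> m \<in> carrier M} \<union>
    {frag_of (n, m \<oplus>\<^bsub>M\<^esub> m') - frag_of (n, m) - frag_of (n, m') | n m m'.
        n \<in> carrier N \<and> m \<in> carrier M \<and> m' \<in> carrier M} \<union>
    {frag_of (a \<odot>\<^bsub>N\<^esub> n, m) - frag_of (n, a \<odot>\<^bsub>M\<^esub> m) | a n m.
        a \<in> carrier R \<and> n \<in> carrier N \<and> m \<in> carrier M}"

abbreviation tensor_free ::
  "('r, 'n, 'j) module_scheme \<Rightarrow> ('r, 'm, 'l) module_scheme \<Rightarrow> ('n \<times> 'm \<Rightarrow>\<^sub>0 int) monoid" where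
  "tensor_free N M \<equiv> free_Abelian_group (carrier N \<times> carrier M)"

definition tensor ::
  "('r, 'k) ring_scheme \<Rightarrow> ('r, 'n, 'j) module_scheme \<Rightarrow> ('r, 'm, 'l) module_scheme \<Rightarrow>
   ('n \<times> 'm \<Rightarrow>\<^sub>0 int) set monoid" where
  "tensor R N M = tensor_free N M Mod generate (tensor_free N M) (tensor_rels R N M)"

definition pure_tensor ::
  "('r, 'k) ring_scheme \<Rightarrow> ('r, 'n, 'j) module_scheme \<Rightarrow> ('r, 'm, 'l) module_scheme \<Rightarrow>
   'n \<Rightarrow> 'm \<Rightarrow> ('n \<times> 'm \<Rightarrow>\<^sub>0 int) set" where
  "pure_tensor R N M n m =
    generate (tensor_free N M) (tensor_rels R N M) #>\<^bsub>tensor_free N M\<^esub> frag_of (n, m)"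

text \<open>The natural map is first defined on the free abelian group and then passes to cosets;
  \<open>tensor_map_hom\<close> and \<open>tensor_map_pure_tensor\<close> below characterize it.\<close>

definition pre_tensor_map ::
  "('r, 'k) ring_scheme \<Rightarrow> ('r, 'n, 'j) module_scheme \<Rightarrow> ('r, 'm, 'l) module_scheme \<Rightarrow>
   ('n \<times> 'm \<Rightarrow>\<^sub>0 int) \<Rightarrow> ('m \<Rightarrow> 'r) \<Rightarrow> 'n" where
  "pre_tensor_map R N M c = (\<lambda>w\<in>carrier (dual R M).
    \<Oplus>\<^bsub>N\<^esub>p\<in>Poly_Mapping.keys c. add_pow N (Poly_Mapping.lookup c p) (w (snd p) \<odot>\<^bsub>N\<^esub> fst p))"

definition tensor_map ::
  "('r, 'k) ring_scheme \<Rightarrow> ('r, 'n, 'j) module_scheme \<Rightarrow> ('r, 'm, 'l) module_scheme \<Rightarrow>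
   ('n \<times> 'm \<Rightarrow>\<^sub>0 int) set \<Rightarrow> ('m \<Rightarrow> 'r) \<Rightarrow> 'n" where
  "tensor_map R N M C = the_elem (pre_tensor_map R N M ` C)"

text \<open>HOL cannot quantify over all types inside a formula, so the type of the elements of the test
  modules \<open>N\<close> is a parameter. ``For every \<open>N\<close>'' as a conclusion is rendered by a free type
  variable. As a hypothesis it is rendered by the weaker requirement for
  \<open>TYPE((nat \<Rightarrow> 'r) set)\<close>: this type contains a copy of every finitely generated right module,
  its elements being cosets in some \<open>R\<^sup>n\<close>, and an element of a kernel already lives over a finitely
  generated submodule of \<open>N\<close>.\<close>

definition flat_strict_Mittag_Leffler ::
  "'n itself \<Rightarrow> ('r, 'k) ring_scheme \<Rightarrow> ('r, 'm, 'l) module_scheme \<Rightarrow> bool" where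
  "flat_strict_Mittag_Leffler _ R M \<longleftrightarrow>
    (\<forall>N :: ('r, 'n) module. right_module R N \<longrightarrow> inj_on (tensor_map R N M) (carrier (tensor R N M)))"

definition free_of_finite_rank :: "('r, 'k) ring_scheme \<Rightarrow> ('r, 'm, 'l) module_scheme \<Rightarrow> 'm set \<Rightarrow> bool" where
  "free_of_finite_rank R M F \<longleftrightarrow>
    (\<exists>B. finite B \<and> B \<subseteq> F \<and>
      (\<forall>x\<in>F. \<exists>!c. c \<in> B \<rightarrow>\<^sub>E carrier R \<and> x = (\<Oplus>\<^bsub>M\<^esub>b\<in>B. c b \<odot>\<^bsub>M\<^esub> b)))"

definition direct_summand :: "('r, 'k) ring_scheme \<Rightarrow> ('r, 'm, 'l) module_scheme \<Rightarrow> 'm set \<Rightarrow> bool" where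
  "direct_summand R M F \<longleftrightarrow> submodule F R M \<and>
    (\<exists>G. submodule G R M \<and> F \<inter> G = {\<zero>\<^bsub>M\<^esub>} \<and> F <+>\<^bsub>M\<^esub> G = carrier M)"

definition finite_free_direct_summands ::
  "('r, 'k) ring_scheme \<Rightarrow> ('r, 'm, 'l) module_scheme \<Rightarrow> 'm set set" where
  "finite_free_direct_summands R M = {F. direct_summand R M F \<and> free_of_finite_rank R M F}"

definition limit_of_finite_free_direct_summands ::
  "('r, 'k) ring_scheme \<Rightarrow> ('r, 'm, 'l) module_scheme \<Rightarrow> bool" where
  "limit_of_finite_free_direct_summands R M \<longleftrightarrow>
    (\<forall>F\<in>finite_free_direct_summands R M. \<forall>G\<in>finite_free_direct_summands R M.
       \<exists>H\<in>finite_free_direct_summands R M. F \<subseteq> H \<and> G \<subseteq> H) \<and>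
    \<Union>(finite_free_direct_summands R M) = carrier M"

lemma pre_tensor_map_hom_pointwise:
  assumes "right_module R N" "left_module R M" and w: "w \<in> carrier (dual R M)"
  shows "(\<lambda>c. pre_tensor_map R N M c w) \<in> hom (tensor_free N M) (add_monoid N)"
proof -
  interpret N: right_module R N by fact
  let ?f = "\<lambda>p. w (snd p) \<odot>\<^bsub>N\<^esub> fst p"
  let ?S = "carrier N \<times> carrier M"
  have f: "?f p \<in> carrier N" if "p \<in> ?S" for p
    using that w by (auto simp: dual_def intro!: N.smult_closed)
  have eq: "pre_tensor_map R N M c w = (\<Oplus>\<^bsub>N\<^esub>p\<in>A. add_pow N (Poly_Mapping.lookup c p) (?f p))"
    if "finite A" "Poly_Mapping.keys c \<subseteq> A" "A \<subseteq> ?S" for c A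
  proof -
    have "(\<Oplus>\<^bsub>N\<^esub>p\<in>Poly_Mapping.keys c. add_pow N (Poly_Mapping.lookup c p) (?f p))
        = (\<Oplus>\<^bsub>N\<^esub>p\<in>A. add_pow N (Poly_Mapping.lookup c p) (?f p))"
    proof (rule N.add.finprod_mono_neutral_cong_left)
      show "add_pow N (Poly_Mapping.lookup c p) (?f p) = \<zero>\<^bsub>N\<^esub>" if "p \<in> A - Poly_Mapping.keys c" for p
        using that by (simp add: in_keys_iff add_pow_def)
    qed (use that f in \<open>auto intro!: N.add.int_pow_closed\<close>)
    then show ?thesis
      using w by (simp add: pre_tensor_map_def)
  qed
  show ?thesis
  proof (rule homI)
    fix c assume "c \<in> carrier (tensor_free N M)"
    then have c: "Poly_Mapping.keys c \<subseteq> ?S" by simp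
    show "pre_tensor_map R N M c w \<in> carrier (add_monoid N)"
      unfolding eq[OF finite_keys subset_refl c]
      using c f by (auto intro!: N.finsum_closed N.add.int_pow_closed)
  next
    fix c d assume "c \<in> carrier (tensor_free N M)" "d \<in> carrier (tensor_free N M)"
    then have c: "Poly_Mapping.keys c \<subseteq> ?S" and d: "Poly_Mapping.keys d \<subseteq> ?S" by simp_all
    let ?A = "Poly_Mapping.keys c \<union> Poly_Mapping.keys d"
    have A: "finite ?A" "?A \<subseteq> ?S" using c d by simp_all
    have "pre_tensor_map R N M (c + d) w
        = (\<Oplus>\<^bsub>N\<^esub>p\<in>?A. add_pow N (Poly_Mapping.lookup c p) (?f p) \<oplus>\<^bsub>N\<^esub> add_pow N (Poly_Mapping.lookup d p) (?f p))"
      unfolding eq[OF A(1) keys_add A(2)]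
      using A f by (intro N.add.finprod_cong') (auto simp: lookup_add N.add.int_pow_mult
          intro!: N.add.int_pow_closed N.add.m_closed)
    also have "\<dots> = pre_tensor_map R N M c w \<oplus>\<^bsub>N\<^esub> pre_tensor_map R N M d w"
      unfolding eq[OF A(1) Un_upper1 A(2)] eq[OF A(1) Un_upper2 A(2)]
      using A f by (intro N.finsum_addf) (auto intro!: N.add.int_pow_closed)
    finally show "pre_tensor_map R N M (c \<otimes>\<^bsub>tensor_free N M\<^esub> d) w
        = pre_tensor_map R N M c w \<otimes>\<^bsub>add_monoid N\<^esub> pre_tensor_map R N M d w" by simp
  qed
qed

lemma pre_tensor_map_frag_of:
  assumes "right_module R N" "n \<in> carrier N" "m \<in> carrier M"
  shows "pre_tensor_map R N M (frag_of (n, m)) = (\<lambda>w\<in>carrier (dual R M). w m \<odot>\<^bsub>N\<^esub> n)"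
proof
  interpret N: right_module R N by fact
  fix w
  show "pre_tensor_map R N M (frag_of (n, m)) w = (\<lambda>w\<in>carrier (dual R M). w m \<odot>\<^bsub>N\<^esub> n) w"
  proof (cases "w \<in> carrier (dual R M)")
    case True
    then have "w m \<odot>\<^bsub>N\<^esub> n \<in> carrier N"
      using assms by (auto simp: dual_def)
    then show ?thesis
      using True by (simp add: pre_tensor_map_def)
  qed (simp add: pre_tensor_map_def)
qed

lemma dual_closed:
  assumes "left_module R M"
  shows "x \<in> carrier (dual R M) \<Longrightarrow> y \<in> carrier (dual R M) \<Longrightarrow> x \<oplus>\<^bsub>dual R M\<^esub> y \<in> carrier (dual R M)"
    and "a \<in> carrier R \<Longrightarrow> x \<in> carrier (dual R M) \<Longrightarrow> a \<odot>\<^bsub>dual R M\<^esub> x \<in> carrier (dual R M)"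
proof -
  interpret M: left_module R M by fact
  show "x \<in> carrier (dual R M) \<Longrightarrow> y \<in> carrier (dual R M) \<Longrightarrow> x \<oplus>\<^bsub>dual R M\<^esub> y \<in> carrier (dual R M)"
    by (auto simp: dual_def PiE_iff M.R.ring_simprules)
  show "a \<in> carrier R \<Longrightarrow> x \<in> carrier (dual R M) \<Longrightarrow> a \<odot>\<^bsub>dual R M\<^esub> x \<in> carrier (dual R M)"
    by (auto simp: dual_def PiE_iff M.R.ring_simprules)
qed

lemma right_module_dual:
  assumes "left_module R M"
  shows "right_module R (dual R M)"
proof -
  interpret M: left_module R M by fact
  have "abelian_group (dual R M)"
  proof (rule abelian_groupI)
    fix x assume x: "x \<in> carrier (dual R M)"
    let ?y = "\<lambda>m\<in>carrier M. \<ominus>\<^bsub>R\<^esub> x m"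
    have "?y \<in> carrier (dual R M)" "?y \<oplus>\<^bsub>dual R M\<^esub> x = \<zero>\<^bsub>dual R M\<^esub>"
      using x by (auto simp: dual_def PiE_iff M.R.l_neg M.R.minus_add M.R.r_minus intro!: restrict_ext)
    then show "\<exists>y\<in>carrier (dual R M). y \<oplus>\<^bsub>dual R M\<^esub> x = \<zero>\<^bsub>dual R M\<^esub>" by blast
  next
    fix x assume x: "x \<in> carrier (dual R M)"
    show "\<zero>\<^bsub>dual R M\<^esub> \<oplus>\<^bsub>dual R M\<^esub> x = x"
      using x by (auto simp: dual_def PiE_iff fun_eq_iff extensional_def restrict_def)
  qed (auto simp: dual_closed[OF assms], auto simp: dual_def PiE_iff M.R.ring_simprules intro!: restrict_ext)
  moreover have "ring R" by (rule M.R.ring_axioms)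
  moreover have "right_module_axioms R (dual R M)"
    apply unfold_locales
        apply (rule dual_closed[OF assms]; assumption)
       apply (auto simp: dual_def PiE_iff M.R.ring_simprules intro!: restrict_ext)[3]
    apply (auto simp: dual_def PiE_iff fun_eq_iff extensional_def restrict_def)
    done
  ultimately show ?thesis
    by (simp add: right_module_def)
qed

lemma pre_tensor_map_hom:
  assumes RN: "right_module R N" and M: "left_module R M"
  shows "pre_tensor_map R N M \<in> hom (tensor_free N M) (right_hom_group R (dual R M) N)"
proof -
  interpret N: right_module R N by fact
  interpret D: right_module R "dual R M" by (rule right_module_dual[OF M])
  let ?H = "carrier (right_hom_group R (dual R M) N)"
  note hp = pre_tensor_map_hom_pointwise[OF RN M]
  have gh: "group_hom (tensor_free N M) (add_monoid N) (\<lambda>c. pre_tensor_map R N M c w)"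
    if "w \<in> carrier (dual R M)" for w
    using hp[OF that] N.N.a_group by (simp add: group_hom_def group_hom_axioms_def)
  have diff: "pre_tensor_map R N M (c - d) w = pre_tensor_map R N M c w \<ominus>\<^bsub>N\<^esub> pre_tensor_map R N M d w"
    if "Poly_Mapping.keys c \<subseteq> carrier N \<times> carrier M" "Poly_Mapping.keys d \<subseteq> carrier N \<times> carrier M"
      "w \<in> carrier (dual R M)" for c d w
  proof -
    interpret group_hom "tensor_free N M" "add_monoid N" "\<lambda>c. pre_tensor_map R N M c w"
      by (rule gh) fact
    have "pre_tensor_map R N M (c \<otimes>\<^bsub>tensor_free N M\<^esub> inv\<^bsub>tensor_free N M\<^esub> d) w
      = pre_tensor_map R N M c w \<otimes>\<^bsub>add_monoid N\<^esub> inv\<^bsub>add_monoid N\<^esub> pre_tensor_map R N M d w"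
      using that hom_mult[of c "inv\<^bsub>tensor_free N M\<^esub> d"] hom_inv[of d] by (simp del: mult_free_Abelian_group)
    then show ?thesis
      using that by (simp add: a_minus_def a_inv_def)
  qed
  have ext: "pre_tensor_map R N M c \<in> extensional (carrier (dual R M))" for c
    by (simp add: pre_tensor_map_def)
  have carr: "pre_tensor_map R N M c \<in> ?H" if "Poly_Mapping.keys c \<subseteq> carrier N \<times> carrier M" for c
  proof (rule free_Abelian_group_induct[OF that])
    have "pre_tensor_map R N M 0 = (\<lambda>w\<in>carrier (dual R M). \<zero>\<^bsub>N\<^esub>)"
      by (auto simp: pre_tensor_map_def)
    moreover have "a \<odot>\<^bsub>N\<^esub> \<zero>\<^bsub>N\<^esub> = \<zero>\<^bsub>N\<^esub>" if "a \<in> carrier R" for a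
      using N.smult_r_distr[OF that N.N.zero_closed N.N.zero_closed] that
      by (metis N.N.add.r_cancel_one' N.N.r_zero N.N.zero_closed N.smult_closed)
    ultimately show "pre_tensor_map R N M 0 \<in> ?H"
      by (auto simp: right_hom_group_def)
  next
    fix c d
    assume cd: "Poly_Mapping.keys c \<subseteq> carrier N \<times> carrier M"
      "Poly_Mapping.keys d \<subseteq> carrier N \<times> carrier M"
      "pre_tensor_map R N M c \<in> ?H" "pre_tensor_map R N M d \<in> ?H"
    have sm: "a \<odot>\<^bsub>N\<^esub> (x \<ominus>\<^bsub>N\<^esub> y) = a \<odot>\<^bsub>N\<^esub> x \<ominus>\<^bsub>N\<^esub> a \<odot>\<^bsub>N\<^esub> y"
      if "a \<in> carrier R" "x \<in> carrier N" "y \<in> carrier N" for a x y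
    proof -
      have "a \<odot>\<^bsub>N\<^esub> (x \<ominus>\<^bsub>N\<^esub> y) \<oplus>\<^bsub>N\<^esub> a \<odot>\<^bsub>N\<^esub> y = a \<odot>\<^bsub>N\<^esub> x"
        using that by (subst N.smult_r_distr[symmetric]) (auto simp: a_minus_def N.N.a_assoc N.N.l_neg)
      then show ?thesis
        using that by (metis N.N.add.inv_solve_right N.N.minus_closed N.smult_closed a_minus_def)
    qed
    have ad: "(x \<oplus>\<^bsub>N\<^esub> y) \<ominus>\<^bsub>N\<^esub> (x' \<oplus>\<^bsub>N\<^esub> y') = (x \<ominus>\<^bsub>N\<^esub> x') \<oplus>\<^bsub>N\<^esub> (y \<ominus>\<^bsub>N\<^esub> y')"
      if "x \<in> carrier N" "y \<in> carrier N" "x' \<in> carrier N" "y' \<in> carrier N" for x y x' y'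
      using that by (simp add: a_minus_def N.N.minus_add N.N.a_ac)
    show "pre_tensor_map R N M (c - d) \<in> ?H"
      using cd ext[of "c - d"]
      by (auto simp: right_hom_group_def PiE_iff diff sm ad)
  next
    fix p assume "p \<in> carrier N \<times> carrier M"
    then obtain n m where p: "p = (n, m)" "n \<in> carrier N" "m \<in> carrier M" by auto
    have "v m \<in> carrier R" if "v \<in> carrier (dual R M)" for v
      using that p by (auto simp: dual_def)
    moreover have "(x \<oplus>\<^bsub>dual R M\<^esub> y) m = x m \<oplus>\<^bsub>R\<^esub> y m" "(a \<odot>\<^bsub>dual R M\<^esub> x) m = x m \<otimes>\<^bsub>R\<^esub> a" for a x y
      using p by (auto simp: dual_def)
    ultimately show "pre_tensor_map R N M (frag_of p) \<in> ?H"
      using p by (auto simp: right_hom_group_def pre_tensor_map_frag_of[OF RN] N.smult_l_distr N.smult_assoc)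
  qed
  show ?thesis
  proof (rule homI)
    fix c d assume cd: "c \<in> carrier (tensor_free N M)" "d \<in> carrier (tensor_free N M)"
    show "pre_tensor_map R N M (c \<otimes>\<^bsub>tensor_free N M\<^esub> d) =
        pre_tensor_map R N M c \<otimes>\<^bsub>right_hom_group R (dual R M) N\<^esub> pre_tensor_map R N M d"
    proof
      fix w
      show "pre_tensor_map R N M (c \<otimes>\<^bsub>tensor_free N M\<^esub> d) w =
        (pre_tensor_map R N M c \<otimes>\<^bsub>right_hom_group R (dual R M) N\<^esub> pre_tensor_map R N M d) w"
        using hom_mult[OF hp cd, of w] ext[of "c + d"]
        by (cases "w \<in> carrier (dual R M)") (auto simp: right_hom_group_def extensional_def)
    qed
  qed (use carr in auto)
qed

lemma group_right_hom_group:
  assumes "right_module R N" "right_module R P"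
  shows "group (right_hom_group R P N)"
proof -
  interpret N: right_module R N by fact
  interpret P: right_module R P by fact
  have sz: "a \<odot>\<^bsub>N\<^esub> \<zero>\<^bsub>N\<^esub> = \<zero>\<^bsub>N\<^esub>" if "a \<in> carrier R" for a
    using N.smult_r_distr[OF that N.N.zero_closed N.N.zero_closed] that
    by (metis N.N.add.r_cancel_one' N.N.r_zero N.N.zero_closed N.smult_closed)
  have sm: "a \<odot>\<^bsub>N\<^esub> (\<ominus>\<^bsub>N\<^esub> x) = \<ominus>\<^bsub>N\<^esub> (a \<odot>\<^bsub>N\<^esub> x)" if "a \<in> carrier R" "x \<in> carrier N" for a x
    using that sz N.smult_r_distr[of a "\<ominus>\<^bsub>N\<^esub> x" x] N.N.minus_equality[of "a \<odot>\<^bsub>N\<^esub> (\<ominus>\<^bsub>N\<^esub> x)" "a \<odot>\<^bsub>N\<^esub> x"]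
    by (simp add: N.N.l_neg)
  show ?thesis
  proof (rule groupI)
    fix f assume f: "f \<in> carrier (right_hom_group R P N)"
    let ?g = "\<lambda>x\<in>carrier P. \<ominus>\<^bsub>N\<^esub> f x"
    have "?g \<in> carrier (right_hom_group R P N)"
      "?g \<otimes>\<^bsub>right_hom_group R P N\<^esub> f = \<one>\<^bsub>right_hom_group R P N\<^esub>"
      using f by (auto simp: right_hom_group_def PiE_iff N.N.l_neg N.N.minus_add sm intro!: restrict_ext)
    then show "\<exists>g\<in>carrier (right_hom_group R P N).
        g \<otimes>\<^bsub>right_hom_group R P N\<^esub> f = \<one>\<^bsub>right_hom_group R P N\<^esub>" by blast
  next
    fix f assume "f \<in> carrier (right_hom_group R P N)"
    then show "\<one>\<^bsub>right_hom_group R P N\<^esub> \<otimes>\<^bsub>right_hom_group R P N\<^esub> f = f"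
      by (auto simp: right_hom_group_def PiE_iff fun_eq_iff extensional_def restrict_def)
  qed (auto simp: right_hom_group_def PiE_iff sz N.N.a_ac N.smult_r_distr intro!: restrict_ext)
qed

lemma tensor_rels_subset:
  assumes "right_module R N" "left_module R M"
  shows "tensor_rels R N M \<subseteq> carrier (tensor_free N M)"
proof -
  interpret N: right_module R N by fact
  interpret M: left_module R M by fact
  have fr: "frag_of p \<in> carrier (tensor_free N M)" if "p \<in> carrier N \<times> carrier M" for p
    using that by simp
  have df: "c - d \<in> carrier (tensor_free N M)"
    if "c \<in> carrier (tensor_free N M)" "d \<in> carrier (tensor_free N M)" for c d
    using that keys_diff[of c d] by auto
  show ?thesis
    unfolding tensor_rels_def by (auto simp del: carrier_free_Abelian_group_iff intro!: df fr)
qed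

lemma tensor_map_coset:
  assumes RN: "right_module R N" and M: "left_module R M"
    and c: "c \<in> carrier (tensor_free N M)"
  shows "tensor_map R N M (generate (tensor_free N M) (tensor_rels R N M) #>\<^bsub>tensor_free N M\<^esub> c)
    = pre_tensor_map R N M c"
proof -
  interpret N: right_module R N by fact
  interpret M: left_module R M by fact
  let ?F = "tensor_free N M" and ?H = "right_hom_group R (dual R M) N"
  let ?K = "generate ?F (tensor_rels R N M)"
  interpret F: group ?F by simp
  interpret h: group_hom ?F ?H "pre_tensor_map R N M"
    using pre_tensor_map_hom[OF RN M] group_right_hom_group[OF RN right_module_dual[OF M]]
    by (simp add: group_hom_def group_hom_axioms_def)
  have "tensor_rels R N M \<subseteq> kernel ?F ?H (pre_tensor_map R N M)"
  proof
    fix r assume r: "r \<in> tensor_rels R N M"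
    have rF: "r \<in> carrier ?F" using r tensor_rels_subset[OF RN M] by blast
    have "pre_tensor_map R N M r = \<one>\<^bsub>?H\<^esub>"
    proof
      fix w
      show "pre_tensor_map R N M r w = \<one>\<^bsub>?H\<^esub> w"
      proof (cases "w \<in> carrier (dual R M)")
        case True
        interpret g: group_hom ?F "add_monoid N" "\<lambda>c. pre_tensor_map R N M c w"
          using pre_tensor_map_hom_pointwise[OF RN M True] N.N.a_group
          by (simp add: group_hom_def group_hom_axioms_def)
        have ad: "pre_tensor_map R N M (x + y) w = pre_tensor_map R N M x w \<oplus>\<^bsub>N\<^esub> pre_tensor_map R N M y w"
          if "x \<in> carrier ?F" "y \<in> carrier ?F" for x y
          using g.hom_mult[OF that] by simp
        have df: "pre_tensor_map R N M (x - y) w = pre_tensor_map R N M x w \<ominus>\<^bsub>N\<^esub> pre_tensor_map R N M y w"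
          if "x \<in> carrier ?F" "y \<in> carrier ?F" for x y
          using ad[of x "-y"] g.hom_inv[OF that(2)] that by (simp add: a_minus_def a_inv_def)
        have dc: "x - y \<in> carrier ?F" if "x \<in> carrier ?F" "y \<in> carrier ?F" for x y
          using that keys_diff[of x y] by auto
        have fr: "frag_of (n, m) \<in> carrier ?F"
            "pre_tensor_map R N M (frag_of (n, m)) w = w m \<odot>\<^bsub>N\<^esub> n"
          if "n \<in> carrier N" "m \<in> carrier M" for n m
          using that pre_tensor_map_frag_of[OF RN that] True by simp_all
        have w: "w m \<in> carrier R" "w (m \<oplus>\<^bsub>M\<^esub> m') = w m \<oplus>\<^bsub>R\<^esub> w m'" "a \<in> carrier R \<Longrightarrow> w (a \<odot>\<^bsub>M\<^esub> m) = a \<otimes>\<^bsub>R\<^esub> w m"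
          if "m \<in> carrier M" "m' \<in> carrier M" for m m' a
          using True that by (auto simp: dual_def)
        have z: "((x \<oplus>\<^bsub>N\<^esub> y) \<ominus>\<^bsub>N\<^esub> x) \<ominus>\<^bsub>N\<^esub> y = \<zero>\<^bsub>N\<^esub>" "x \<ominus>\<^bsub>N\<^esub> x = \<zero>\<^bsub>N\<^esub>"
          if "x \<in> carrier N" "y \<in> carrier N" for x y
        proof -
          show "x \<ominus>\<^bsub>N\<^esub> x = \<zero>\<^bsub>N\<^esub>" using that by (simp add: a_minus_def N.N.r_neg)
          have "(x \<oplus>\<^bsub>N\<^esub> y) \<ominus>\<^bsub>N\<^esub> x = y"
            using that by (metis N.N.a_comm N.N.minus_closed N.N.r_neg1 N.N.a_assoc N.N.a_inv_closed a_minus_def N.N.r_neg N.N.r_zero)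
          then show "((x \<oplus>\<^bsub>N\<^esub> y) \<ominus>\<^bsub>N\<^esub> x) \<ominus>\<^bsub>N\<^esub> y = \<zero>\<^bsub>N\<^esub>"
            using that by (simp add: a_minus_def N.N.r_neg)
        qed
        have "pre_tensor_map R N M r w = \<zero>\<^bsub>N\<^esub>"
          using r unfolding tensor_rels_def
          by (auto simp: df dc fr w z N.smult_l_distr N.smult_r_distr N.smult_assoc
              simp del: carrier_free_Abelian_group_iff)
        then show ?thesis using True by (simp add: right_hom_group_def)
      qed (simp add: pre_tensor_map_def right_hom_group_def)
    qed
    then show "r \<in> kernel ?F ?H (pre_tensor_map R N M)"
      using rF by (simp add: kernel_def)
  qed
  then have K: "?K \<subseteq> kernel ?F ?H (pre_tensor_map R N M)"
    by (intro F.generate_subgroup_incl h.subgroup_kernel)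
  have "pre_tensor_map R N M ` (?K #>\<^bsub>?F\<^esub> c) = {pre_tensor_map R N M c}"
  proof (rule antisym; rule subsetI)
    fix y assume "y \<in> pre_tensor_map R N M ` (?K #>\<^bsub>?F\<^esub> c)"
    then obtain k where "k \<in> ?K" and y: "y = pre_tensor_map R N M (k \<otimes>\<^bsub>?F\<^esub> c)"
      unfolding r_coset_def by blast
    then have "k \<in> carrier ?F" "pre_tensor_map R N M k = \<one>\<^bsub>?H\<^esub>"
      using K unfolding kernel_def by blast+
    then show "y \<in> {pre_tensor_map R N M c}"
      using h.hom_mult[of k c] h.hom_closed[OF c] c y h.H.l_one by (simp del: carrier_free_Abelian_group_iff mult_free_Abelian_group)
  next
    fix y assume y: "y \<in> {pre_tensor_map R N M c}"
    have "c = \<one>\<^bsub>?F\<^esub> \<otimes>\<^bsub>?F\<^esub> c" by simp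
    then have "c \<in> ?K #>\<^bsub>?F\<^esub> c"
      unfolding r_coset_def using generate.one[of ?F] by blast
    then show "y \<in> pre_tensor_map R N M ` (?K #>\<^bsub>?F\<^esub> c)" using y by blast
  qed
  then show ?thesis
    by (simp add: tensor_map_def)
qed

lemma tensor_map_pure_tensor:
  assumes "right_module R N" "left_module R M" "n \<in> carrier N" "m \<in> carrier M"
  shows "tensor_map R N M (pure_tensor R N M n m) = (\<lambda>w\<in>carrier (dual R M). w m \<odot>\<^bsub>N\<^esub> n)"
  using assms by (simp add: pure_tensor_def tensor_map_coset pre_tensor_map_frag_of)

lemma tensor_map_hom:
  assumes RN: "right_module R N" and M: "left_module R M"
  shows "tensor_map R N M \<in> hom (tensor R N M) (right_hom_group R (dual R M) N)"
proof -
  let ?F = "tensor_free N M" and ?H = "right_hom_group R (dual R M) N"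
  let ?K = "generate ?F (tensor_rels R N M)"
  have cF: "comm_group ?F" by (rule abelian_free_Abelian_group)
  have nK: "?K \<lhd> ?F"
    by (intro comm_group.subgroup_imp_normal[OF cF] group.generate_is_subgroup tensor_rels_subset assms) simp
  note ph = pre_tensor_map_hom[OF RN M]
  show ?thesis
  proof (rule homI)
    fix C assume "C \<in> carrier (tensor R N M)"
    then obtain c where "c \<in> carrier ?F" "C = ?K #>\<^bsub>?F\<^esub> c"
      by (auto simp: tensor_def carrier_FactGroup simp del: carrier_free_Abelian_group_iff)
    then show "tensor_map R N M C \<in> carrier ?H"
      using tensor_map_coset[OF RN M] hom_in_carrier[OF ph] by simp
  next
    fix C D assume "C \<in> carrier (tensor R N M)" "D \<in> carrier (tensor R N M)"
    then obtain c d where c: "c \<in> carrier ?F" "C = ?K #>\<^bsub>?F\<^esub> c" and d: "d \<in> carrier ?F" "D = ?K #>\<^bsub>?F\<^esub> d"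
      by (auto simp: tensor_def carrier_FactGroup simp del: carrier_free_Abelian_group_iff)
    have "C \<otimes>\<^bsub>tensor R N M\<^esub> D = ?K #>\<^bsub>?F\<^esub> (c \<otimes>\<^bsub>?F\<^esub> d)"
      using normal.rcos_sum[OF nK c(1) d(1)] c(2) d(2) by (simp add: tensor_def)
    then show "tensor_map R N M (C \<otimes>\<^bsub>tensor R N M\<^esub> D) = tensor_map R N M C \<otimes>\<^bsub>?H\<^esub> tensor_map R N M D"
      using tensor_map_coset[OF RN M] hom_mult[OF ph c(1) d(1)] monoid.m_closed[OF group.is_monoid[OF group_free_Abelian_group] c(1) d(1)] c d
      by (simp del: carrier_free_Abelian_group_iff mult_free_Abelian_group)
  qed
qed

end

theory Submission
  imports Defs
begin

text \<open>
  Over a local ring, both conditions amount to this: finitely many elements of \<open>M\<close> are always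
  determined linearly by their values under finitely many functionals. A submodule \<open>F\<close> is a finite free direct summand if and only if there
  are a finite set \<open>B\<close> and functionals \<open>f b \<in> M\<^sup>*\<close> with \<open>f b b' = \<delta>\<close> such that \<open>F\<close> consists of
  the \<open>x\<close> with \<open>x = \<Sum> f b x \<cdot> b\<close>
  (\<open>span_of_finite_free_direct_summand\<close>, \<open>finite_free_direct_summand_dual_system\<close>).

  Let \<open>M\<close> be the directed union of its finite free direct summands. The second factors of a tensor
  \<open>c\<close> all lie in one such \<open>F\<close>, and moving the coefficients \<open>f b m\<close> to the left turns \<open>c\<close> into
  \<open>\<Sum> n\<^sub>b \<otimes> b\<close>, where \<open>n\<^sub>b\<close> is the value at \<open>f b\<close> of the image of \<open>c\<close> under the natural map. If
  that image is zero, then so is \<open>c\<close> (\<open>tensor_relation_of_kernel\<close>).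

  Conversely, let the natural maps be injective. For \<open>x \<in> M\<close> let \<open>I\<close> be the right ideal of the
  values \<open>w x\<close>. The natural map for \<open>N = R / I\<close> kills \<open>1 \<otimes> x\<close>, so \<open>x \<in> I M\<close>, that is,
  \<open>x = \<Sum> w\<^sub>i x \<cdot> m\<^sub>i\<close>: some endomorphism of finite rank fixes \<open>x\<close>
  (\<open>finite_rank_fixes_of_Mittag_Leffler\<close>). If \<open>\<phi>\<close> fixes a set \<open>K\<close> and \<open>\<psi>\<close> fixes \<open>x - \<phi> x\<close>,
  then \<open>\<phi> + \<psi> (1 - \<phi>)\<close> fixes \<open>K \<union> {x}\<close>, so every finite set \<open>K\<close> is fixed by a single
  endomorphism of finite rank (\<open>finite_rank_fixes_finite_set\<close>).

  This is where the ring being local enters. Take an expansion \<open>x = \<Sum> w\<^sub>i x \<cdot> m\<^sub>i\<close> that is valid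
  for all \<open>x \<in> K\<close> and has as few terms as possible. A relation \<open>\<Sum> w\<^sub>i x \<cdot> y\<^sub>i = 0\<close> on \<open>K\<close> with
  some \<open>y\<^sub>k\<close> a unit would allow the removal of the term \<open>k\<close>. Applying \<open>w\<^sub>i\<close> to the expansion shows
  that the \<open>\<delta>\<^sub>i\<^sub>j - w\<^sub>i m\<^sub>j\<close> (\<open>i\<close> fixed) are the coefficients of such a relation; so they are non-units
  (\<open>minimal_dual_expansion\<close>). As the non-units form an ideal, the matrix \<open>w\<^sub>i m\<^sub>j\<close> has units on its diagonal and non-units off
  it, and Gaussian elimination changes the \<open>w\<^sub>i\<close> to functionals that are exactly dual to the \<open>m\<^sub>j\<close>
  (\<open>biorthogonalize_functionals\<close>). The \<open>m\<^sub>j\<close> then span a finite free direct summand containing \<open>K\<close>.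
  Applied to the union of two bases, this gives directedness; applied to singletons, it gives that
  the summands cover \<open>M\<close>.
\<close>

section \<open>Left modules and their duals\<close>

context left_module
begin

lemma zero_smult [simp]:
  assumes "x \<in> carrier M"
  shows "\<zero>\<^bsub>R\<^esub> \<odot>\<^bsub>M\<^esub> x = \<zero>\<^bsub>M\<^esub>"
  using assms smult_l_distr[of "\<zero>\<^bsub>R\<^esub>" "\<zero>\<^bsub>R\<^esub>" x]
  by (metis M.add.r_cancel_one' R.l_zero R.zero_closed smult_closed)

lemma smult_zero [simp]:
  assumes "a \<in> carrier R"
  shows "a \<odot>\<^bsub>M\<^esub> \<zero>\<^bsub>M\<^esub> = \<zero>\<^bsub>M\<^esub>"
  using assms smult_r_distr[of a "\<zero>\<^bsub>M\<^esub>" "\<zero>\<^bsub>M\<^esub>"]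
  by (metis M.add.r_cancel_one' M.l_zero M.zero_closed smult_closed)

lemma neg_smult:
  assumes "a \<in> carrier R" "x \<in> carrier M"
  shows "(\<ominus>\<^bsub>R\<^esub> a) \<odot>\<^bsub>M\<^esub> x = \<ominus>\<^bsub>M\<^esub> (a \<odot>\<^bsub>M\<^esub> x)"
  using assms smult_l_distr[of "\<ominus>\<^bsub>R\<^esub> a" a x]
  by (metis M.minus_equality R.add.inv_closed R.l_neg smult_closed zero_smult)

lemma smult_neg:
  assumes "a \<in> carrier R" "x \<in> carrier M"
  shows "a \<odot>\<^bsub>M\<^esub> (\<ominus>\<^bsub>M\<^esub> x) = \<ominus>\<^bsub>M\<^esub> (a \<odot>\<^bsub>M\<^esub> x)"
  using assms smult_r_distr[of a "\<ominus>\<^bsub>M\<^esub> x" x]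
  by (metis M.add.inv_closed M.l_neg M.minus_equality smult_closed smult_zero)

lemma finsum_smult_left:
  assumes "a \<in> carrier R" "f \<in> I \<rightarrow> carrier M"
  shows "a \<odot>\<^bsub>M\<^esub> (\<Oplus>\<^bsub>M\<^esub>i\<in>I. f i) = (\<Oplus>\<^bsub>M\<^esub>i\<in>I. a \<odot>\<^bsub>M\<^esub> f i)"
  using assms(2)
  by (induction I rule: infinite_finite_induct)
    (use assms(1) in \<open>auto simp: Pi_iff smult_r_distr\<close>)

lemma finsum_smult_right:
  assumes "x \<in> carrier M" "f \<in> I \<rightarrow> carrier R"
  shows "(\<Oplus>\<^bsub>R\<^esub>i\<in>I. f i) \<odot>\<^bsub>M\<^esub> x = (\<Oplus>\<^bsub>M\<^esub>i\<in>I. f i \<odot>\<^bsub>M\<^esub> x)"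
  using assms(2)
  by (induction I rule: infinite_finite_induct)
    (use assms(1) in \<open>auto simp: Pi_iff smult_l_distr\<close>)

lemma finsum_neg:
  assumes "f \<in> I \<rightarrow> carrier M"
  shows "\<ominus>\<^bsub>M\<^esub> (\<Oplus>\<^bsub>M\<^esub>i\<in>I. f i) = (\<Oplus>\<^bsub>M\<^esub>i\<in>I. \<ominus>\<^bsub>M\<^esub> f i)"
  using assms
  by (induction I rule: infinite_finite_induct) (auto simp: Pi_iff M.minus_add)

lemma finsum_delta:
  assumes "finite I" "k \<in> I" "f \<in> I \<rightarrow> carrier M"
  shows "(\<Oplus>\<^bsub>M\<^esub>i\<in>I. (if i = k then \<one>\<^bsub>R\<^esub> else \<zero>\<^bsub>R\<^esub>) \<odot>\<^bsub>M\<^esub> f i) = f k"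
proof -
  have "(\<Oplus>\<^bsub>M\<^esub>i\<in>I. (if i = k then \<one>\<^bsub>R\<^esub> else \<zero>\<^bsub>R\<^esub>) \<odot>\<^bsub>M\<^esub> f i) = (\<Oplus>\<^bsub>M\<^esub>i\<in>I. if k = i then f i else \<zero>\<^bsub>M\<^esub>)"
    using assms by (intro M.finsum_cong') (auto simp: Pi_iff)
  also have "\<dots> = f k"
    using assms by (intro M.finsum_singleton) auto
  finally show ?thesis .
qed

lemma dual_app_closed [simp, intro]:
  "\<lbrakk>w \<in> carrier (dual R M); x \<in> carrier M\<rbrakk> \<Longrightarrow> w x \<in> carrier R"
  by (auto simp: dual_def)

lemma dual_app_add:
  "\<lbrakk>w \<in> carrier (dual R M); x \<in> carrier M; y \<in> carrier M\<rbrakk> \<Longrightarrow> w (x \<oplus>\<^bsub>M\<^esub> y) = w x \<oplus>\<^bsub>R\<^esub> w y"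
  by (auto simp: dual_def)

lemma dual_app_smult:
  "\<lbrakk>w \<in> carrier (dual R M); a \<in> carrier R; x \<in> carrier M\<rbrakk> \<Longrightarrow> w (a \<odot>\<^bsub>M\<^esub> x) = a \<otimes>\<^bsub>R\<^esub> w x"
  by (auto simp: dual_def)

lemma dual_app_zero [simp]:
  assumes "w \<in> carrier (dual R M)"
  shows "w \<zero>\<^bsub>M\<^esub> = \<zero>\<^bsub>R\<^esub>"
  using dual_app_smult[OF assms R.zero_closed M.zero_closed] assms by simp

lemma dual_app_neg:
  assumes "w \<in> carrier (dual R M)" "x \<in> carrier M"
  shows "w (\<ominus>\<^bsub>M\<^esub> x) = \<ominus>\<^bsub>R\<^esub> w x"
  using dual_app_add[OF assms(1), of "\<ominus>\<^bsub>M\<^esub> x" x] assms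
  by (metis M.add.inv_closed M.l_neg R.minus_equality dual_app_closed dual_app_zero)

lemma dual_app_finsum:
  assumes "w \<in> carrier (dual R M)" "f \<in> I \<rightarrow> carrier M"
  shows "w (\<Oplus>\<^bsub>M\<^esub>i\<in>I. f i) = (\<Oplus>\<^bsub>R\<^esub>i\<in>I. w (f i))"
  using assms(2)
  by (induction I rule: infinite_finite_induct)
    (use assms(1) in \<open>auto simp: Pi_iff dual_app_add\<close>)

text \<open>
  \<open>M\<^sup>*\<close> is a right module. Only the values of its operations matter later, so this lemma and the next
  one provide functionals with prescribed values and hide the extensional functions behind them.
\<close>

lemma dual_scale:
  assumes "w \<in> carrier (dual R M)" "a \<in> carrier R"
  obtains u where "u \<in> carrier (dual R M)" "\<And>x. x \<in> carrier M \<Longrightarrow> u x = w x \<otimes>\<^bsub>R\<^esub> a"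
proof
  show "a \<odot>\<^bsub>dual R M\<^esub> w \<in> carrier (dual R M)"
    by (rule dual_closed(2)[OF left_module_axioms assms(2,1)])
qed (simp add: dual_def)

lemma dual_diff_scale:
  assumes "v \<in> carrier (dual R M)" "w \<in> carrier (dual R M)" "a \<in> carrier R"
  obtains u where "u \<in> carrier (dual R M)" "\<And>x. x \<in> carrier M \<Longrightarrow> u x = v x \<ominus>\<^bsub>R\<^esub> w x \<otimes>\<^bsub>R\<^esub> a"
proof -
  obtain t where t: "t \<in> carrier (dual R M)" "\<And>x. x \<in> carrier M \<Longrightarrow> t x = w x \<otimes>\<^bsub>R\<^esub> (\<ominus>\<^bsub>R\<^esub> a)"
    using dual_scale[OF assms(2), of "\<ominus>\<^bsub>R\<^esub> a"] assms(3) by auto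
  show thesis
  proof
    show "v \<oplus>\<^bsub>dual R M\<^esub> t \<in> carrier (dual R M)"
      by (rule dual_closed(1)[OF left_module_axioms assms(1) t(1)])
    fix x assume "x \<in> carrier M"
    then show "(v \<oplus>\<^bsub>dual R M\<^esub> t) x = v x \<ominus>\<^bsub>R\<^esub> w x \<otimes>\<^bsub>R\<^esub> a"
      using assms t by (simp add: dual_def a_minus_def R.r_minus)
  qed
qed

text \<open>
  Closure under negation comes from multiplication by \<open>- 1\<close>.
\<close>

lemma submoduleI:
  assumes "H \<subseteq> carrier M" "\<zero>\<^bsub>M\<^esub> \<in> H" "\<And>x y. \<lbrakk>x \<in> H; y \<in> H\<rbrakk> \<Longrightarrow> x \<oplus>\<^bsub>M\<^esub> y \<in> H"
    and sm: "\<And>a x. \<lbrakk>a \<in> carrier R; x \<in> H\<rbrakk> \<Longrightarrow> a \<odot>\<^bsub>M\<^esub> x \<in> H"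
  shows "submodule H R M"
proof -
  have "\<ominus>\<^bsub>M\<^esub> x \<in> H" if "x \<in> H" for x
    using sm[of "\<ominus>\<^bsub>R\<^esub> \<one>\<^bsub>R\<^esub>" x] assms(1) that by (auto simp: neg_smult)
  then show ?thesis
    by (intro submodule.intro subgroup.intro submodule_axioms.intro)
      (use assms in \<open>auto simp: a_inv_def\<close>)
qed

lemma submoduleD:
  assumes "submodule H R M"
  shows "H \<subseteq> carrier M" "\<zero>\<^bsub>M\<^esub> \<in> H" "\<And>x y. \<lbrakk>x \<in> H; y \<in> H\<rbrakk> \<Longrightarrow> x \<oplus>\<^bsub>M\<^esub> y \<in> H"
    "\<And>a x. \<lbrakk>a \<in> carrier R; x \<in> H\<rbrakk> \<Longrightarrow> a \<odot>\<^bsub>M\<^esub> x \<in> H" "\<And>x. x \<in> H \<Longrightarrow> \<ominus>\<^bsub>M\<^esub> x \<in> H"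
proof -
  interpret H: submodule H R M by fact
  show sub: "H \<subseteq> carrier M" using H.subset by simp
  show "\<zero>\<^bsub>M\<^esub> \<in> H" using H.one_closed by simp
  show "\<And>x y. \<lbrakk>x \<in> H; y \<in> H\<rbrakk> \<Longrightarrow> x \<oplus>\<^bsub>M\<^esub> y \<in> H" using H.m_closed by simp
  show sm: "\<And>a x. \<lbrakk>a \<in> carrier R; x \<in> H\<rbrakk> \<Longrightarrow> a \<odot>\<^bsub>M\<^esub> x \<in> H" by (rule H.smult_closed)
  show "\<ominus>\<^bsub>M\<^esub> x \<in> H" if "x \<in> H" for x
    using sm[of "\<ominus>\<^bsub>R\<^esub> \<one>\<^bsub>R\<^esub>" x] subsetD[OF sub that] that by (simp add: neg_smult)
qed

lemma submodule_finsum: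
  assumes H: "submodule H R M" and B: "finite B" "B \<subseteq> H" and c: "c \<in> B \<rightarrow> carrier R"
  shows "(\<Oplus>\<^bsub>M\<^esub>b\<in>B. c b \<odot>\<^bsub>M\<^esub> b) \<in> H"
  using B c
proof (induction B)
  case (insert b B)
  have "c b' \<odot>\<^bsub>M\<^esub> b' \<in> H" if "b' \<in> insert b B" for b'
    using that insert.prems submoduleD(4)[OF H, of "c b'" b'] by auto
  then show ?case
    using insert submoduleD(1,3)[OF H] by (subst M.finsum_insert) (auto simp: subset_iff)
qed (simp add: submoduleD(2)[OF H])

section \<open>Finite free direct summands and dual systems\<close>

text \<open>
  A finite set together with biorthogonal functionals, indexed by the set itself. This is the data of
  a projection of \<open>M\<close> onto a free module with basis \<open>B\<close>.
\<close>

definition dual_system :: "'m set \<Rightarrow> ('m \<Rightarrow> 'm \<Rightarrow> 'r) \<Rightarrow> bool" where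
  "dual_system B f \<longleftrightarrow> finite B \<and> B \<subseteq> carrier M \<and> f \<in> B \<rightarrow> carrier (dual R M) \<and>
    (\<forall>b\<in>B. \<forall>b'\<in>B. f b b' = (if b' = b then \<one>\<^bsub>R\<^esub> else \<zero>\<^bsub>R\<^esub>))"

text \<open>
  The fixed points of the projection \<open>x \<mapsto> \<Sum> f b x \<cdot> b\<close>. For a dual system these are exactly the
  linear combinations of \<open>B\<close>; the description by fixed points makes the coefficients linear in \<open>x\<close>.
\<close>

definition span_of :: "'m set \<Rightarrow> ('m \<Rightarrow> 'm \<Rightarrow> 'r) \<Rightarrow> 'm set" where
  "span_of B f = {x \<in> carrier M. x = (\<Oplus>\<^bsub>M\<^esub>b\<in>B. f b x \<odot>\<^bsub>M\<^esub> b)}"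

lemma span_of_least:
  assumes "dual_system B f" "submodule H R M" "B \<subseteq> H"
  shows "span_of B f \<subseteq> H"
proof
  fix x assume x: "x \<in> span_of B f"
  have "(\<Oplus>\<^bsub>M\<^esub>b\<in>B. f b x \<odot>\<^bsub>M\<^esub> b) \<in> H"
    using assms x by (intro submodule_finsum) (auto simp: dual_system_def span_of_def)
  then show "x \<in> H" using x by (simp add: span_of_def)
qed

lemma dual_system_coefficient:
  assumes f: "dual_system B f" and c: "c \<in> B \<rightarrow> carrier R" and k: "k \<in> B"
  shows "f k (\<Oplus>\<^bsub>M\<^esub>b\<in>B. c b \<odot>\<^bsub>M\<^esub> b) = c k"
proof -
  have fin: "finite B" and B: "\<And>b. b \<in> B \<Longrightarrow> b \<in> carrier M"
    and fk: "f k \<in> carrier (dual R M)"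
    using f k by (auto simp: dual_system_def)
  have cc: "c b \<in> carrier R" if "b \<in> B" for b
    using that c by auto
  have "f k (\<Oplus>\<^bsub>M\<^esub>b\<in>B. c b \<odot>\<^bsub>M\<^esub> b) = (\<Oplus>\<^bsub>R\<^esub>b\<in>B. f k (c b \<odot>\<^bsub>M\<^esub> b))"
    using B c by (intro dual_app_finsum[OF fk]) auto
  also have "\<dots> = (\<Oplus>\<^bsub>R\<^esub>b\<in>B. if k = b then c b else \<zero>\<^bsub>R\<^esub>)"
    using f k B cc by (intro R.finsum_cong') (auto simp: dual_system_def dual_app_smult[OF fk])
  also have "\<dots> = c k"
    using k fin c by (intro R.finsum_singleton) auto
  finally show ?thesis .
qed

text \<open>
  The projection \<open>x \<mapsto> \<Sum> f b x \<cdot> b\<close> splits \<open>M\<close> into its fixed points and the common kernel of the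
  functionals \<open>f b\<close>, and \<open>f b\<close> reads off the coefficient of \<open>b\<close>, whence the uniqueness of
  coefficients.
\<close>

lemma span_of_finite_free_direct_summand:
  assumes f: "dual_system B f"
  shows "span_of B f \<in> finite_free_direct_summands R M"
proof -
  have fin: "finite B" and B: "\<And>b. b \<in> B \<Longrightarrow> b \<in> carrier M"
    and fd: "\<And>b. b \<in> B \<Longrightarrow> f b \<in> carrier (dual R M)"
    using f by (auto simp: dual_system_def)
  let ?s = "\<lambda>x. \<Oplus>\<^bsub>M\<^esub>b\<in>B. f b x \<odot>\<^bsub>M\<^esub> b"
  let ?F = "span_of B f" and ?G = "{x \<in> carrier M. \<forall>b\<in>B. f b x = \<zero>\<^bsub>R\<^esub>}"
  have tc: "f b x \<odot>\<^bsub>M\<^esub> b \<in> carrier M" if "x \<in> carrier M" "b \<in> B" for x b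
    using that B fd by auto
  have sc: "?s x \<in> carrier M" if "x \<in> carrier M" for x
    using that tc by (intro M.finsum_closed) auto
  have comb: "(\<Oplus>\<^bsub>M\<^esub>b\<in>B. c b \<odot>\<^bsub>M\<^esub> b) \<in> ?F" if c: "c \<in> B \<rightarrow> carrier R" for c
  proof -
    have c': "(\<Oplus>\<^bsub>M\<^esub>b\<in>B. c b \<odot>\<^bsub>M\<^esub> b) \<in> carrier M"
      using c B by (intro M.finsum_closed) auto
    moreover have "?s (\<Oplus>\<^bsub>M\<^esub>b\<in>B. c b \<odot>\<^bsub>M\<^esub> b) = (\<Oplus>\<^bsub>M\<^esub>b\<in>B. c b \<odot>\<^bsub>M\<^esub> b)"
      using c B by (intro M.finsum_cong') (auto simp: dual_system_coefficient[OF f c])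
    ultimately show ?thesis by (simp add: span_of_def)
  qed
  have F: "submodule ?F R M"
  proof (rule submoduleI)
    have "\<zero>\<^bsub>M\<^esub> = (\<Oplus>\<^bsub>M\<^esub>b\<in>B. \<zero>\<^bsub>R\<^esub> \<odot>\<^bsub>M\<^esub> b)"
      using B by (intro sym[OF M.add.finprod_one_eqI]) auto
    then show "\<zero>\<^bsub>M\<^esub> \<in> ?F" using comb[of "\<lambda>_. \<zero>\<^bsub>R\<^esub>"] by simp
  next
    fix x y assume xy: "x \<in> ?F" "y \<in> ?F"
    then have cxy: "x \<in> carrier M" "y \<in> carrier M" "x = ?s x" "y = ?s y" by (auto simp: span_of_def)
    have "?s (x \<oplus>\<^bsub>M\<^esub> y) = (\<Oplus>\<^bsub>M\<^esub>b\<in>B. f b x \<odot>\<^bsub>M\<^esub> b \<oplus>\<^bsub>M\<^esub> f b y \<odot>\<^bsub>M\<^esub> b)"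
      using cxy(1,2) B fd by (intro M.finsum_cong') (auto simp: dual_app_add smult_l_distr)
    also have "\<dots> = ?s x \<oplus>\<^bsub>M\<^esub> ?s y"
      using cxy(1,2) tc by (intro M.finsum_addf) auto
    finally show "x \<oplus>\<^bsub>M\<^esub> y \<in> ?F" using cxy by (simp add: span_of_def)
  next
    fix a x assume a: "a \<in> carrier R" and x: "x \<in> ?F"
    then have cx: "x \<in> carrier M" "x = ?s x" by (auto simp: span_of_def)
    have "?s (a \<odot>\<^bsub>M\<^esub> x) = (\<Oplus>\<^bsub>M\<^esub>b\<in>B. a \<odot>\<^bsub>M\<^esub> (f b x \<odot>\<^bsub>M\<^esub> b))"
      using cx(1) a B fd by (intro M.finsum_cong') (auto simp: dual_app_smult smult_assoc)
    also have "\<dots> = a \<odot>\<^bsub>M\<^esub> ?s x"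
      using cx(1) a tc by (intro finsum_smult_left[symmetric]) auto
    finally show "a \<odot>\<^bsub>M\<^esub> x \<in> ?F" using cx a by (simp add: span_of_def)
  qed (auto simp: span_of_def)
  have G: "submodule ?G R M"
    by (rule submoduleI) (use fd in \<open>auto simp: dual_app_add dual_app_smult\<close>)
  have FG: "?F \<inter> ?G = {\<zero>\<^bsub>M\<^esub>}"
  proof -
    have "x = \<zero>\<^bsub>M\<^esub>" if "x \<in> ?F" "x \<in> ?G" for x
    proof -
      have "?s x = \<zero>\<^bsub>M\<^esub>"
        using that B by (intro M.add.finprod_one_eqI) auto
      then show ?thesis using that by (simp add: span_of_def)
    qed
    then show ?thesis using submoduleD(2)[OF F] submoduleD(2)[OF G] by blast
  qed
  have "?F <+>\<^bsub>M\<^esub> ?G = carrier M"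
  proof
    show "?F <+>\<^bsub>M\<^esub> ?G \<subseteq> carrier M"
      using submoduleD(1)[OF F] submoduleD(1)[OF G] by (auto simp: set_add_def')
    show "carrier M \<subseteq> ?F <+>\<^bsub>M\<^esub> ?G"
    proof
      fix x assume x: "x \<in> carrier M"
      have s: "?s x \<in> ?F" using comb[of "\<lambda>b. f b x"] x fd by auto
      have "x \<ominus>\<^bsub>M\<^esub> ?s x \<in> ?G"
      proof -
        have "f b (x \<ominus>\<^bsub>M\<^esub> ?s x) = \<zero>\<^bsub>R\<^esub>" if b: "b \<in> B" for b
        proof -
          have "f b (x \<ominus>\<^bsub>M\<^esub> ?s x) = f b x \<oplus>\<^bsub>R\<^esub> \<ominus>\<^bsub>R\<^esub> f b (?s x)"
            using b x sc fd by (simp add: a_minus_def dual_app_add dual_app_neg)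
          also have "f b (?s x) = f b x"
            using dual_system_coefficient[OF f _ b, of "\<lambda>b. f b x"] x fd by auto
          finally show ?thesis using b x fd by (simp add: R.r_neg)
        qed
        then show ?thesis using x sc by simp
      qed
      moreover have "x = ?s x \<oplus>\<^bsub>M\<^esub> (x \<ominus>\<^bsub>M\<^esub> ?s x)"
        using x sc[OF x] by (simp add: a_minus_def M.a_lcomm[of "?s x" x] M.r_neg)
      ultimately show "x \<in> ?F <+>\<^bsub>M\<^esub> ?G" using s by (auto simp: set_add_def')
    qed
  qed
  then have "direct_summand R M ?F"
    using F G FG by (auto simp: direct_summand_def)
  moreover have "free_of_finite_rank R M ?F"
    unfolding free_of_finite_rank_def
  proof (intro exI[of _ B] conjI ballI)
    show "finite B" by (rule fin)
    show "B \<subseteq> ?F"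
    proof
      fix k assume k: "k \<in> B"
      have "(\<Oplus>\<^bsub>M\<^esub>b\<in>B. (if b = k then \<one>\<^bsub>R\<^esub> else \<zero>\<^bsub>R\<^esub>) \<odot>\<^bsub>M\<^esub> b) = k"
        using fin k B by (intro finsum_delta[of B k "\<lambda>b. b"]) auto
      then show "k \<in> ?F" using comb[of "\<lambda>b. if b = k then \<one>\<^bsub>R\<^esub> else \<zero>\<^bsub>R\<^esub>"] by auto
    qed
    fix x assume "x \<in> ?F"
    then have x: "x \<in> carrier M" "x = ?s x" by (auto simp: span_of_def)
    show "\<exists>!c. c \<in> B \<rightarrow>\<^sub>E carrier R \<and> x = (\<Oplus>\<^bsub>M\<^esub>b\<in>B. c b \<odot>\<^bsub>M\<^esub> b)"
    proof (rule ex1I[of _ "\<lambda>b\<in>B. f b x"])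
      have "(\<Oplus>\<^bsub>M\<^esub>b\<in>B. (\<lambda>b\<in>B. f b x) b \<odot>\<^bsub>M\<^esub> b) = ?s x"
        using x B fd by (intro M.finsum_cong') auto
      then show "(\<lambda>b\<in>B. f b x) \<in> B \<rightarrow>\<^sub>E carrier R \<and> x = (\<Oplus>\<^bsub>M\<^esub>b\<in>B. (\<lambda>b\<in>B. f b x) b \<odot>\<^bsub>M\<^esub> b)"
        using x fd by auto
    next
      fix c assume c: "c \<in> B \<rightarrow>\<^sub>E carrier R \<and> x = (\<Oplus>\<^bsub>M\<^esub>b\<in>B. c b \<odot>\<^bsub>M\<^esub> b)"
      then have "f b x = c b" if "b \<in> B" for b
        using dual_system_coefficient[OF f _ that, of c] by auto
      then show "c = (\<lambda>b\<in>B. f b x)" using c by (auto simp: fun_eq_iff PiE_def extensional_def)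
    qed
  qed
  ultimately show ?thesis by (simp add: finite_free_direct_summands_def)
qed

text \<open>
  Let \<open>M = F \<oplus> G\<close> with \<open>B\<close> a basis of \<open>F\<close>. The functional \<open>f b\<close> sends \<open>x\<close> to the coefficient of \<open>b\<close>
  in the \<open>F\<close>-component of \<open>x\<close>; it is linear because these coefficients are unique.
\<close>

lemma finite_free_direct_summand_dual_system:
  assumes "F \<in> finite_free_direct_summands R M"
  obtains B f where "dual_system B f" "F = span_of B f"
proof -
  obtain B G where F: "submodule F R M" and G: "submodule G R M" and FG: "F \<inter> G = {\<zero>\<^bsub>M\<^esub>}"
    and sum: "F <+>\<^bsub>M\<^esub> G = carrier M" and fin: "finite B" and BF: "B \<subseteq> F"
    and ex1: "\<forall>x\<in>F. \<exists>!c. c \<in> B \<rightarrow>\<^sub>E carrier R \<and> x = (\<Oplus>\<^bsub>M\<^esub>b\<in>B. c b \<odot>\<^bsub>M\<^esub> b)"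
    using assms by (auto simp: finite_free_direct_summands_def direct_summand_def free_of_finite_rank_def)
  note F' = submoduleD[OF F] and G' = submoduleD[OF G]
  have B: "b \<in> carrier M" if "b \<in> B" for b using that BF F'(1) by auto
  let ?s = "\<lambda>c. \<Oplus>\<^bsub>M\<^esub>b\<in>B. c b \<odot>\<^bsub>M\<^esub> b"
  have sF: "?s c \<in> F" if "c \<in> B \<rightarrow> carrier R" for c
    by (rule submodule_finsum[OF F fin BF that])
  \<comment> \<open>\<open>c\<close> is the family of coordinates of the \<open>F\<close>-component of \<open>x\<close>.\<close>
  define rep where "rep x c \<longleftrightarrow> c \<in> B \<rightarrow>\<^sub>E carrier R \<and> (\<exists>g\<in>G. x = ?s c \<oplus>\<^bsub>M\<^esub> g)" for x c
  have unique: "c = d" if c: "rep x c" and d: "rep x d" for x c d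
  proof -
    obtain g h where g: "g \<in> G" "h \<in> G" and eq: "?s c \<oplus>\<^bsub>M\<^esub> g = ?s d \<oplus>\<^bsub>M\<^esub> h"
      using c d by (auto simp: rep_def)
    have cd: "?s c \<in> F" "?s d \<in> F" using c d by (auto simp: rep_def PiE_def intro!: sF)
    then have M: "?s c \<in> carrier M" "?s d \<in> carrier M" "g \<in> carrier M" "h \<in> carrier M"
      using g F'(1) G'(1) by auto
    have "?s c \<ominus>\<^bsub>M\<^esub> ?s d = h \<ominus>\<^bsub>M\<^esub> g"
    proof -
      have "?s c = (?s d \<oplus>\<^bsub>M\<^esub> h) \<ominus>\<^bsub>M\<^esub> g"
        using M eq[symmetric] by (simp add: a_minus_def M.a_assoc M.r_neg)
      also have "\<dots> = ?s d \<oplus>\<^bsub>M\<^esub> (h \<ominus>\<^bsub>M\<^esub> g)"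
        using M by (simp add: a_minus_def M.a_assoc)
      also have "\<dots> \<ominus>\<^bsub>M\<^esub> ?s d = h \<ominus>\<^bsub>M\<^esub> g"
        using M by (simp add: a_minus_def M.a_ac M.r_neg2 M.r_neg1 M.r_neg)
      finally show ?thesis .
    qed
    then have "?s c \<ominus>\<^bsub>M\<^esub> ?s d \<in> F \<inter> G"
      using F'(3)[OF cd(1) F'(5)[OF cd(2)]] G'(3)[OF g(2) G'(5)[OF g(1)]] by (simp add: a_minus_def)
    then have "?s c = ?s d" using FG M M.minus_equality[of "?s c" "\<ominus>\<^bsub>M\<^esub> ?s d"] by (simp add: a_minus_def M.minus_minus)
    then have c': "c \<in> B \<rightarrow>\<^sub>E carrier R \<and> ?s c = ?s c" and d': "d \<in> B \<rightarrow>\<^sub>E carrier R \<and> ?s c = ?s d"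
      using c d by (simp_all add: rep_def)
    note e = bspec[OF ex1 cd(1)]
    show "c = d" by (rule trans[OF sym[OF the1_equality[OF e, OF c']] the1_equality[OF e, OF d']])
  qed
  have exists: "\<exists>c. rep x c" if x: "x \<in> carrier M" for x
  proof -
    have "x \<in> F <+>\<^bsub>M\<^esub> G" using x sum by simp
    then obtain y g where y: "y \<in> F" "g \<in> G" "x = y \<oplus>\<^bsub>M\<^esub> g"
      by (auto simp: set_add_def')
    obtain c where "c \<in> B \<rightarrow>\<^sub>E carrier R" "y = ?s c" using bspec[OF ex1 y(1)] by blast
    then show ?thesis using y unfolding rep_def by blast
  qed
  define co where "co x = (THE c. rep x c)" for x
  have co: "rep x (co x)" if x: "x \<in> carrier M" for x
  proof -
    obtain c where c: "rep x c" using exists[OF x] by blast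
    show ?thesis unfolding co_def by (rule theI[of "rep x", OF c unique[OF _ c]])
  qed
  have coR: "co x b \<in> carrier R" if "x \<in> carrier M" "b \<in> B" for x b
    using co[OF that(1)] that(2) by (auto simp: rep_def)
  have co_eq: "co x = c" if "rep x c" "x \<in> carrier M" for x c
    using unique[OF co[OF that(2)] that(1)] .
  have co_add: "co (x \<oplus>\<^bsub>M\<^esub> y) b = co x b \<oplus>\<^bsub>R\<^esub> co y b" if xy: "x \<in> carrier M" "y \<in> carrier M" and b: "b \<in> B" for x y b
  proof -
    obtain g h where g: "g \<in> G" "h \<in> G" and x: "x = ?s (co x) \<oplus>\<^bsub>M\<^esub> g" and y: "y = ?s (co y) \<oplus>\<^bsub>M\<^esub> h"
      using co[OF xy(1)] co[OF xy(2)] by (auto simp: rep_def)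
    let ?c = "\<lambda>b\<in>B. co x b \<oplus>\<^bsub>R\<^esub> co y b"
    have M: "?s (co x) \<in> carrier M" "?s (co y) \<in> carrier M" "g \<in> carrier M" "h \<in> carrier M"
      using xy coR B g G'(1) by (auto intro!: M.finsum_closed)
    have "?s ?c = (\<Oplus>\<^bsub>M\<^esub>b\<in>B. co x b \<odot>\<^bsub>M\<^esub> b \<oplus>\<^bsub>M\<^esub> co y b \<odot>\<^bsub>M\<^esub> b)"
      using xy coR B by (intro M.finsum_cong') (auto simp: smult_l_distr)
    also have "\<dots> = ?s (co x) \<oplus>\<^bsub>M\<^esub> ?s (co y)"
      using xy coR B by (intro M.finsum_addf) auto
    finally have "?s ?c \<oplus>\<^bsub>M\<^esub> (g \<oplus>\<^bsub>M\<^esub> h) = (?s (co x) \<oplus>\<^bsub>M\<^esub> g) \<oplus>\<^bsub>M\<^esub> (?s (co y) \<oplus>\<^bsub>M\<^esub> h)"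
      using M by (simp add: M.a_ac)
    then have "x \<oplus>\<^bsub>M\<^esub> y = ?s ?c \<oplus>\<^bsub>M\<^esub> (g \<oplus>\<^bsub>M\<^esub> h)" using x y by simp
    then have "rep (x \<oplus>\<^bsub>M\<^esub> y) ?c" using xy coR G'(3)[OF g] by (auto simp: rep_def)
    then show ?thesis using co_eq[of "x \<oplus>\<^bsub>M\<^esub> y" ?c] xy b by simp
  qed
  have co_smult: "co (a \<odot>\<^bsub>M\<^esub> x) b = a \<otimes>\<^bsub>R\<^esub> co x b" if a: "a \<in> carrier R" and xM: "x \<in> carrier M" and b: "b \<in> B" for a x b
  proof -
    obtain g where g: "g \<in> G" and x: "x = ?s (co x) \<oplus>\<^bsub>M\<^esub> g"
      using co[OF xM] by (auto simp: rep_def)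
    let ?c = "\<lambda>b\<in>B. a \<otimes>\<^bsub>R\<^esub> co x b"
    have M: "?s (co x) \<in> carrier M" "g \<in> carrier M"
      using xM coR B g G'(1) by (auto intro!: M.finsum_closed)
    have "?s ?c = (\<Oplus>\<^bsub>M\<^esub>b\<in>B. a \<odot>\<^bsub>M\<^esub> (co x b \<odot>\<^bsub>M\<^esub> b))"
      using a xM coR B by (intro M.finsum_cong') (auto simp: smult_assoc)
    also have "\<dots> = a \<odot>\<^bsub>M\<^esub> ?s (co x)"
      using a xM coR B by (intro finsum_smult_left[symmetric]) auto
    finally have "?s ?c \<oplus>\<^bsub>M\<^esub> a \<odot>\<^bsub>M\<^esub> g = a \<odot>\<^bsub>M\<^esub> (?s (co x) \<oplus>\<^bsub>M\<^esub> g)"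
      using M a by (simp add: smult_r_distr)
    then have "a \<odot>\<^bsub>M\<^esub> x = ?s ?c \<oplus>\<^bsub>M\<^esub> a \<odot>\<^bsub>M\<^esub> g" using x by simp
    then have "rep (a \<odot>\<^bsub>M\<^esub> x) ?c" using xM a coR G'(4)[OF a g] by (auto simp: rep_def)
    then show ?thesis using co_eq[of "a \<odot>\<^bsub>M\<^esub> x" ?c] xM a b by simp
  qed
  have co_F: "co x = c" if "x = ?s c" "c \<in> B \<rightarrow>\<^sub>E carrier R" for x c
  proof -
    have "x \<in> carrier M" using that sF[of c] F'(1) by (auto simp: PiE_def)
    moreover from this have "rep x c" using that G'(2) by (auto simp: rep_def intro!: bexI[of _ "\<zero>\<^bsub>M\<^esub>"])
    ultimately show ?thesis by (simp add: co_eq)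
  qed
  let ?f = "\<lambda>b. \<lambda>x\<in>carrier M. co x b"
  have "?f b \<in> carrier (dual R M)" if "b \<in> B" for b
    using that coR by (auto simp: dual_def co_add co_smult)
  moreover have "?f b k = (if k = b then \<one>\<^bsub>R\<^esub> else \<zero>\<^bsub>R\<^esub>)" if b: "b \<in> B" and k: "k \<in> B" for b k
  proof -
    let ?c = "\<lambda>b\<in>B. if b = k then \<one>\<^bsub>R\<^esub> else \<zero>\<^bsub>R\<^esub>"
    have "?s ?c = (\<Oplus>\<^bsub>M\<^esub>b\<in>B. (if b = k then \<one>\<^bsub>R\<^esub> else \<zero>\<^bsub>R\<^esub>) \<odot>\<^bsub>M\<^esub> b)"
      using B by (intro M.finsum_cong') auto
    also have "\<dots> = k"
      using fin k B by (intro finsum_delta[of B k "\<lambda>b. b"]) auto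
    finally have "co k = ?c" by (intro co_F) auto
    then show ?thesis using b B[OF k] by auto
  qed
  ultimately have ds: "dual_system B ?f"
    using fin B by (auto simp: dual_system_def)
  moreover have "F = span_of B ?f"
  proof
    show "F \<subseteq> span_of B ?f"
    proof
      fix x assume x: "x \<in> F"
      then obtain c where c: "c \<in> B \<rightarrow>\<^sub>E carrier R" "x = ?s c" using ex1 by blast
      have xM: "x \<in> carrier M" using x F'(1) by auto
      have "(\<Oplus>\<^bsub>M\<^esub>b\<in>B. ?f b x \<odot>\<^bsub>M\<^esub> b) = ?s c"
        using c(1) B xM co_F[OF c(2,1)] by (intro M.finsum_cong') auto
      then show "x \<in> span_of B ?f" using xM c(2) by (simp add: span_of_def)
    qed
    show "span_of B ?f \<subseteq> F"
    proof
      fix x assume "x \<in> span_of B ?f"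
      then have x: "x \<in> carrier M" "x = (\<Oplus>\<^bsub>M\<^esub>b\<in>B. ?f b x \<odot>\<^bsub>M\<^esub> b)" by (auto simp: span_of_def)
      have "(\<Oplus>\<^bsub>M\<^esub>b\<in>B. ?f b x \<odot>\<^bsub>M\<^esub> b) \<in> F"
        using x(1) coR by (intro sF) auto
      then show "x \<in> F" using x(2) by simp
    qed
  qed
  ultimately show thesis by (rule that)
qed

section \<open>Endomorphisms of finite rank\<close>

definition finite_rank :: "('m \<Rightarrow> 'm) \<Rightarrow> bool" where
  "finite_rank \<phi> \<longleftrightarrow> (\<exists>n::nat. \<exists>w m. w \<in> {..<n} \<rightarrow> carrier (dual R M) \<and> m \<in> {..<n} \<rightarrow> carrier M \<and>
    (\<forall>x\<in>carrier M. \<phi> x = (\<Oplus>\<^bsub>M\<^esub>i\<in>{..<n}. w i x \<odot>\<^bsub>M\<^esub> m i)))"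

lemma finsum_split:
  fixes n k :: nat
  assumes "g \<in> {..<n + k} \<rightarrow> carrier M"
  shows "(\<Oplus>\<^bsub>M\<^esub>i\<in>{..<n + k}. g i) = (\<Oplus>\<^bsub>M\<^esub>i\<in>{..<n}. g i) \<oplus>\<^bsub>M\<^esub> (\<Oplus>\<^bsub>M\<^esub>i\<in>{..<k}. g (n + i))"
  using assms
proof (induction k)
  case 0
  then show ?case by (auto simp: Pi_iff)
next
  case (Suc k)
  have g: "\<And>i. i < n + Suc k \<Longrightarrow> g i \<in> carrier M" using Suc.prems by auto
  have IH: "(\<Oplus>\<^bsub>M\<^esub>i\<in>{..<n + k}. g i) = (\<Oplus>\<^bsub>M\<^esub>i\<in>{..<n}. g i) \<oplus>\<^bsub>M\<^esub> (\<Oplus>\<^bsub>M\<^esub>i\<in>{..<k}. g (n + i))"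
    using g by (intro Suc.IH) auto
  have "(\<Oplus>\<^bsub>M\<^esub>i\<in>{..<n + Suc k}. g i) = g (n + k) \<oplus>\<^bsub>M\<^esub> (\<Oplus>\<^bsub>M\<^esub>i\<in>{..<n + k}. g i)"
    using g by (simp add: lessThan_Suc Pi_iff)
  moreover have "(\<Oplus>\<^bsub>M\<^esub>i\<in>{..<Suc k}. g (n + i)) = g (n + k) \<oplus>\<^bsub>M\<^esub> (\<Oplus>\<^bsub>M\<^esub>i\<in>{..<k}. g (n + i))"
    using g by (simp add: lessThan_Suc Pi_iff)
  moreover have "(\<Oplus>\<^bsub>M\<^esub>i\<in>{..<n}. g i) \<in> carrier M" "(\<Oplus>\<^bsub>M\<^esub>i\<in>{..<k}. g (n + i)) \<in> carrier M" "g (n + k) \<in> carrier M"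
    using g by (auto intro!: M.finsum_closed)
  ultimately show ?case using IH by (simp add: M.a_lcomm)
qed

lemma finite_rank_add:
  assumes "finite_rank \<phi>" "finite_rank \<psi>"
  shows "finite_rank (\<lambda>x. \<phi> x \<oplus>\<^bsub>M\<^esub> \<psi> x)"
proof -
  obtain n :: nat and w m where w: "w \<in> {..<n} \<rightarrow> carrier (dual R M)" "m \<in> {..<n} \<rightarrow> carrier M"
    and \<phi>: "\<And>x. x \<in> carrier M \<Longrightarrow> \<phi> x = (\<Oplus>\<^bsub>M\<^esub>i\<in>{..<n}. w i x \<odot>\<^bsub>M\<^esub> m i)"
    using assms(1) by (auto simp: finite_rank_def)
  obtain k :: nat and v l where v: "v \<in> {..<k} \<rightarrow> carrier (dual R M)" "l \<in> {..<k} \<rightarrow> carrier M"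
    and \<psi>: "\<And>x. x \<in> carrier M \<Longrightarrow> \<psi> x = (\<Oplus>\<^bsub>M\<^esub>i\<in>{..<k}. v i x \<odot>\<^bsub>M\<^esub> l i)"
    using assms(2) by (auto simp: finite_rank_def)
  let ?u = "\<lambda>i. if i < n then w i else v (i - n)" and ?p = "\<lambda>i. if i < n then m i else l (i - n)"
  have u: "?u \<in> {..<n + k} \<rightarrow> carrier (dual R M)" and p: "?p \<in> {..<n + k} \<rightarrow> carrier M"
    using w v by (auto simp: Pi_iff)
  have "\<phi> x \<oplus>\<^bsub>M\<^esub> \<psi> x = (\<Oplus>\<^bsub>M\<^esub>i\<in>{..<n + k}. ?u i x \<odot>\<^bsub>M\<^esub> ?p i)" if x: "x \<in> carrier M" for x
  proof -
    have "(\<Oplus>\<^bsub>M\<^esub>i\<in>{..<n + k}. ?u i x \<odot>\<^bsub>M\<^esub> ?p i) =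
      (\<Oplus>\<^bsub>M\<^esub>i\<in>{..<n}. ?u i x \<odot>\<^bsub>M\<^esub> ?p i) \<oplus>\<^bsub>M\<^esub> (\<Oplus>\<^bsub>M\<^esub>i\<in>{..<k}. ?u (n + i) x \<odot>\<^bsub>M\<^esub> ?p (n + i))"
      using u p x by (intro finsum_split) (force simp: Pi_iff)
    also have "(\<Oplus>\<^bsub>M\<^esub>i\<in>{..<n}. ?u i x \<odot>\<^bsub>M\<^esub> ?p i) = \<phi> x"
      unfolding \<phi>[OF x] using w x by (intro M.finsum_cong') (auto simp: Pi_iff)
    also have "(\<Oplus>\<^bsub>M\<^esub>i\<in>{..<k}. ?u (n + i) x \<odot>\<^bsub>M\<^esub> ?p (n + i)) = \<psi> x"
      unfolding \<psi>[OF x] using v x by (intro M.finsum_cong') (auto simp: Pi_iff)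
    finally show ?thesis by simp
  qed
  then show ?thesis unfolding finite_rank_def using u p by blast
qed

lemma finite_rank_zero: "finite_rank (\<lambda>x. \<zero>\<^bsub>M\<^esub>)"
  unfolding finite_rank_def by (intro exI[of _ 0]) auto

lemma finite_rank_single:
  assumes "w \<in> carrier (dual R M)" "m \<in> carrier M"
  shows "finite_rank (\<lambda>x. w x \<odot>\<^bsub>M\<^esub> m)"
  unfolding finite_rank_def
  by (intro exI[of _ "Suc 0"] exI[of _ "\<lambda>_. w"] exI[of _ "\<lambda>_. m"])
    (use assms in \<open>auto simp: lessThan_Suc\<close>)

lemma finite_rank_neg:
  assumes "finite_rank \<phi>"
  shows "finite_rank (\<lambda>x. \<ominus>\<^bsub>M\<^esub> \<phi> x)"
proof -
  obtain n :: nat and w m where w: "w \<in> {..<n} \<rightarrow> carrier (dual R M)" "m \<in> {..<n} \<rightarrow> carrier M"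
    and \<phi>: "\<And>x. x \<in> carrier M \<Longrightarrow> \<phi> x = (\<Oplus>\<^bsub>M\<^esub>i\<in>{..<n}. w i x \<odot>\<^bsub>M\<^esub> m i)"
    using assms(1) by (auto simp: finite_rank_def)
  have "\<ominus>\<^bsub>M\<^esub> \<phi> x = (\<Oplus>\<^bsub>M\<^esub>i\<in>{..<n}. w i x \<odot>\<^bsub>M\<^esub> (\<ominus>\<^bsub>M\<^esub> m i))" if x: "x \<in> carrier M" for x
  proof -
    have "\<ominus>\<^bsub>M\<^esub> \<phi> x = (\<Oplus>\<^bsub>M\<^esub>i\<in>{..<n}. \<ominus>\<^bsub>M\<^esub> (w i x \<odot>\<^bsub>M\<^esub> m i))"
      unfolding \<phi>[OF x] using w x by (intro finsum_neg) (auto simp: Pi_iff)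
    also have "\<dots> = (\<Oplus>\<^bsub>M\<^esub>i\<in>{..<n}. w i x \<odot>\<^bsub>M\<^esub> (\<ominus>\<^bsub>M\<^esub> m i))"
      using w x by (intro M.finsum_cong') (auto simp: Pi_iff smult_neg)
    finally show ?thesis .
  qed
  moreover have "(\<lambda>i. \<ominus>\<^bsub>M\<^esub> m i) \<in> {..<n} \<rightarrow> carrier M" using w by auto
  ultimately show ?thesis
    unfolding finite_rank_def using w(1) by blast
qed

lemma finite_rank_linear:
  assumes "finite_rank \<phi>"
  shows "x \<in> carrier M \<Longrightarrow> \<phi> x \<in> carrier M"
    and "\<lbrakk>x \<in> carrier M; y \<in> carrier M\<rbrakk> \<Longrightarrow> \<phi> (x \<oplus>\<^bsub>M\<^esub> y) = \<phi> x \<oplus>\<^bsub>M\<^esub> \<phi> y"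
    and "\<lbrakk>a \<in> carrier R; x \<in> carrier M\<rbrakk> \<Longrightarrow> \<phi> (a \<odot>\<^bsub>M\<^esub> x) = a \<odot>\<^bsub>M\<^esub> \<phi> x"
proof -
  obtain n :: nat and w m where wm: "w \<in> {..<n} \<rightarrow> carrier (dual R M)" "m \<in> {..<n} \<rightarrow> carrier M"
    and \<phi>: "\<And>x. x \<in> carrier M \<Longrightarrow> \<phi> x = (\<Oplus>\<^bsub>M\<^esub>i\<in>{..<n}. w i x \<odot>\<^bsub>M\<^esub> m i)"
    using assms(1) by (auto simp: finite_rank_def)
  have w: "\<And>i. i < n \<Longrightarrow> w i \<in> carrier (dual R M)" "\<And>i. i < n \<Longrightarrow> m i \<in> carrier M"
    using wm by auto
  have t: "w i x \<odot>\<^bsub>M\<^esub> m i \<in> carrier M" if "x \<in> carrier M" "i < n" for x i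
    using that w by auto
  show "\<phi> x \<in> carrier M" if "x \<in> carrier M" for x
    unfolding \<phi>[OF that] using t[OF that] by (intro M.finsum_closed) auto
  show "\<phi> (x \<oplus>\<^bsub>M\<^esub> y) = \<phi> x \<oplus>\<^bsub>M\<^esub> \<phi> y" if xy: "x \<in> carrier M" "y \<in> carrier M"
  proof -
    have "\<phi> (x \<oplus>\<^bsub>M\<^esub> y) = (\<Oplus>\<^bsub>M\<^esub>i\<in>{..<n}. w i x \<odot>\<^bsub>M\<^esub> m i \<oplus>\<^bsub>M\<^esub> w i y \<odot>\<^bsub>M\<^esub> m i)"
      unfolding \<phi>[OF M.a_closed[OF xy]]
      using xy w by (intro M.finsum_cong') (auto simp: dual_app_add smult_l_distr)
    also have "\<dots> = \<phi> x \<oplus>\<^bsub>M\<^esub> \<phi> y"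
      unfolding \<phi>[OF xy(1)] \<phi>[OF xy(2)] using t xy by (intro M.finsum_addf) auto
    finally show ?thesis .
  qed
  show "\<phi> (a \<odot>\<^bsub>M\<^esub> x) = a \<odot>\<^bsub>M\<^esub> \<phi> x" if ax: "a \<in> carrier R" "x \<in> carrier M"
  proof -
    have "\<phi> (a \<odot>\<^bsub>M\<^esub> x) = (\<Oplus>\<^bsub>M\<^esub>i\<in>{..<n}. a \<odot>\<^bsub>M\<^esub> (w i x \<odot>\<^bsub>M\<^esub> m i))"
      unfolding \<phi>[OF smult_closed[OF ax]]
      using ax w by (intro M.finsum_cong') (auto simp: dual_app_smult smult_assoc)
    also have "\<dots> = a \<odot>\<^bsub>M\<^esub> \<phi> x"
      unfolding \<phi>[OF ax(2)] using t ax by (intro finsum_smult_left[symmetric]) auto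
    finally show ?thesis .
  qed
qed

text \<open>
  If \<open>\<psi> = \<Sum> w\<^sub>i \<cdot> m\<^sub>i\<close>, then \<open>\<psi> (1 - \<phi>) = \<Sum> w\<^sub>i (1 - \<phi>) \<cdot> m\<^sub>i\<close>, and each \<open>w\<^sub>i (1 - \<phi>)\<close> is a functional
  because \<open>\<phi>\<close> is linear.
\<close>

lemma finite_rank_comp_diff:
  assumes \<phi>: "finite_rank \<phi>" and \<psi>: "finite_rank \<psi>"
  shows "finite_rank (\<lambda>x. \<psi> (x \<ominus>\<^bsub>M\<^esub> \<phi> x))"
proof -
  obtain n :: nat and w m where w: "w \<in> {..<n} \<rightarrow> carrier (dual R M)" "m \<in> {..<n} \<rightarrow> carrier M"
    and \<psi>: "\<And>x. x \<in> carrier M \<Longrightarrow> \<psi> x = (\<Oplus>\<^bsub>M\<^esub>i\<in>{..<n}. w i x \<odot>\<^bsub>M\<^esub> m i)"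
    using \<psi> by (auto simp: finite_rank_def)
  note l = finite_rank_linear[OF \<phi>]
  let ?v = "\<lambda>i. \<lambda>x\<in>carrier M. w i (x \<ominus>\<^bsub>M\<^esub> \<phi> x)"
  have "?v i \<in> carrier (dual R M)" if i: "i < n" for i
  proof -
    have wi: "w i \<in> carrier (dual R M)" using w i by auto
    have 1: "(x \<oplus>\<^bsub>M\<^esub> y) \<ominus>\<^bsub>M\<^esub> \<phi> (x \<oplus>\<^bsub>M\<^esub> y) = (x \<ominus>\<^bsub>M\<^esub> \<phi> x) \<oplus>\<^bsub>M\<^esub> (y \<ominus>\<^bsub>M\<^esub> \<phi> y)"
      if "x \<in> carrier M" "y \<in> carrier M" for x y
      using that l by (simp add: a_minus_def M.minus_add M.a_ac)
    have 2: "a \<odot>\<^bsub>M\<^esub> x \<ominus>\<^bsub>M\<^esub> \<phi> (a \<odot>\<^bsub>M\<^esub> x) = a \<odot>\<^bsub>M\<^esub> (x \<ominus>\<^bsub>M\<^esub> \<phi> x)"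
      if "a \<in> carrier R" "x \<in> carrier M" for a x
      using that l by (simp add: a_minus_def smult_r_distr smult_neg)
    have 3: "x \<ominus>\<^bsub>M\<^esub> \<phi> x \<in> carrier M" if "x \<in> carrier M" for x
      using that l by simp
    have "?v i \<in> carrier M \<rightarrow>\<^sub>E carrier R" using wi 3 by auto
    moreover have "?v i (x \<oplus>\<^bsub>M\<^esub> y) = ?v i x \<oplus>\<^bsub>R\<^esub> ?v i y" if "x \<in> carrier M" "y \<in> carrier M" for x y
      using that 3 by (simp add: 1 dual_app_add[OF wi])
    moreover have "?v i (a \<odot>\<^bsub>M\<^esub> x) = a \<otimes>\<^bsub>R\<^esub> ?v i x" if "a \<in> carrier R" "x \<in> carrier M" for a x
      using that 3 by (simp add: 2 dual_app_smult[OF wi])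
    ultimately show ?thesis by (simp add: dual_def)
  qed
  then have v: "?v \<in> {..<n} \<rightarrow> carrier (dual R M)" by simp
  have "\<psi> (x \<ominus>\<^bsub>M\<^esub> \<phi> x) = (\<Oplus>\<^bsub>M\<^esub>i\<in>{..<n}. ?v i x \<odot>\<^bsub>M\<^esub> m i)" if "x \<in> carrier M" for x
    using that l \<psi>[of "x \<ominus>\<^bsub>M\<^esub> \<phi> x"] by simp
  then show ?thesis unfolding finite_rank_def using v w(2) by blast
qed

text \<open>
  Induction on \<open>K\<close>. If \<open>\<phi>\<close> fixes \<open>K\<close> and \<open>\<psi>\<close> fixes the defect \<open>x - \<phi> x\<close> of a new element \<open>x\<close>, then
  \<open>1 - (\<phi> + \<psi> (1 - \<phi>)) = (1 - \<psi>) (1 - \<phi>)\<close> kills both \<open>K\<close> and \<open>x\<close>.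
\<close>

lemma finite_rank_fixes_finite_set:
  assumes single: "\<And>x. x \<in> carrier M \<Longrightarrow> \<exists>\<phi>. finite_rank \<phi> \<and> \<phi> x = x"
    and K: "finite K" "K \<subseteq> carrier M"
  shows "\<exists>\<phi>. finite_rank \<phi> \<and> (\<forall>x\<in>K. \<phi> x = x)"
  using K
proof (induction K)
  case empty
  then show ?case using finite_rank_zero by blast
next
  case (insert x K)
  then obtain \<phi> where \<phi>: "finite_rank \<phi>" "\<And>y. y \<in> K \<Longrightarrow> \<phi> y = y" by auto
  note l = finite_rank_linear[OF \<phi>(1)]
  have x: "x \<in> carrier M" "\<phi> x \<in> carrier M" using insert.prems l by auto
  then obtain \<psi> where \<psi>: "finite_rank \<psi>" "\<psi> (x \<ominus>\<^bsub>M\<^esub> \<phi> x) = x \<ominus>\<^bsub>M\<^esub> \<phi> x"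
    using single[of "x \<ominus>\<^bsub>M\<^esub> \<phi> x"] by auto
  let ?\<chi> = "\<lambda>y. \<phi> y \<oplus>\<^bsub>M\<^esub> \<psi> (y \<ominus>\<^bsub>M\<^esub> \<phi> y)"
  have "\<psi> \<zero>\<^bsub>M\<^esub> = \<zero>\<^bsub>M\<^esub>"
    using finite_rank_linear(3)[OF \<psi>(1) R.zero_closed M.zero_closed] finite_rank_linear(1)[OF \<psi>(1)] by simp
  then have "?\<chi> y = y" if "y \<in> K" for y
    using that insert.prems \<phi>(2)[OF that] by (simp add: a_minus_def M.r_neg subset_iff)
  moreover have "?\<chi> x = x"
    using x by (simp add: \<psi>(2)) (simp add: a_minus_def M.a_ac M.r_neg M.r_neg2 M.r_neg1)
  moreover have "finite_rank ?\<chi>"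
    by (intro finite_rank_add finite_rank_comp_diff \<phi> \<psi>)
  ultimately show ?case by blast
qed

section \<open>Minimal expansions over a local ring\<close>

text \<open>
  An endomorphism of finite rank fixing \<open>K\<close>, with its terms made explicit. The index set is an
  arbitrary finite set of numbers rather than an initial segment so that a term can be removed
  without renumbering.
\<close>

definition dual_expansion :: "'m set \<Rightarrow> nat set \<Rightarrow> (nat \<Rightarrow> 'm \<Rightarrow> 'r) \<Rightarrow> (nat \<Rightarrow> 'm) \<Rightarrow> bool" where
  "dual_expansion K I w m \<longleftrightarrow> finite I \<and> w \<in> I \<rightarrow> carrier (dual R M) \<and> m \<in> I \<rightarrow> carrier M \<and>
    (\<forall>x\<in>K. x = (\<Oplus>\<^bsub>M\<^esub>i\<in>I. w i x \<odot>\<^bsub>M\<^esub> m i))"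

text \<open>
  The relation allows replacing each \<open>m\<^sub>i\<close> by \<open>m\<^sub>i - y\<^sub>i y\<^sub>k\<^sup>-\<^sup>1 \<cdot> m\<^sub>k\<close> without changing the sum at \<open>x \<in> K\<close>, and
  the new \<open>k\<close>-th vector is zero.
\<close>

lemma dual_expansion_remove:
  assumes e: "dual_expansion K I w m" and K: "K \<subseteq> carrier M" and k: "k \<in> I"
    and y: "y \<in> I \<rightarrow> carrier R" "y k \<in> Units R"
    and rel: "\<And>x. x \<in> K \<Longrightarrow> (\<Oplus>\<^bsub>R\<^esub>i\<in>I. w i x \<otimes>\<^bsub>R\<^esub> y i) = \<zero>\<^bsub>R\<^esub>"
  obtains m' where "dual_expansion K (I - {k}) w m'"
proof
  have fin: "finite I" and w: "\<And>i. i \<in> I \<Longrightarrow> w i \<in> carrier (dual R M)" and m: "\<And>i. i \<in> I \<Longrightarrow> m i \<in> carrier M"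
    and exp: "\<And>x. x \<in> K \<Longrightarrow> x = (\<Oplus>\<^bsub>M\<^esub>i\<in>I. w i x \<odot>\<^bsub>M\<^esub> m i)"
    using e by (auto simp: dual_expansion_def)
  have yc: "y i \<in> carrier R" if "i \<in> I" for i using that y by auto
  define u where "u = inv\<^bsub>R\<^esub> y k"
  have u: "u \<in> carrier R" "y k \<otimes>\<^bsub>R\<^esub> u = \<one>\<^bsub>R\<^esub>" using y(2) by (auto simp: u_def)
  let ?t = "u \<odot>\<^bsub>M\<^esub> m k"
  have t: "?t \<in> carrier M" using u m k by auto
  let ?m = "\<lambda>i. m i \<oplus>\<^bsub>M\<^esub> \<ominus>\<^bsub>M\<^esub> (y i \<odot>\<^bsub>M\<^esub> ?t)"
  have m': "?m i \<in> carrier M" if "i \<in> I" for i using that m yc t by auto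
  have mk: "?m k = \<zero>\<^bsub>M\<^esub>"
    using u yc[OF k] m[OF k] by (simp add: smult_assoc[symmetric] M.r_neg)
  have "x = (\<Oplus>\<^bsub>M\<^esub>i\<in>I - {k}. w i x \<odot>\<^bsub>M\<^esub> ?m i)" if x: "x \<in> K" for x
  proof -
    have xM: "x \<in> carrier M" using x K by auto
    have wc: "w i x \<in> carrier R" if "i \<in> I" for i using that w xM by auto
    have "(\<Oplus>\<^bsub>M\<^esub>i\<in>I. w i x \<odot>\<^bsub>M\<^esub> ?m i) =
      (\<Oplus>\<^bsub>M\<^esub>i\<in>I. w i x \<odot>\<^bsub>M\<^esub> m i \<oplus>\<^bsub>M\<^esub> (w i x \<otimes>\<^bsub>R\<^esub> y i) \<odot>\<^bsub>M\<^esub> (\<ominus>\<^bsub>M\<^esub> ?t))"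
      using wc m yc t by (intro M.finsum_cong') (auto simp: smult_r_distr smult_assoc smult_neg)
    also have "\<dots> = (\<Oplus>\<^bsub>M\<^esub>i\<in>I. w i x \<odot>\<^bsub>M\<^esub> m i) \<oplus>\<^bsub>M\<^esub> (\<Oplus>\<^bsub>M\<^esub>i\<in>I. (w i x \<otimes>\<^bsub>R\<^esub> y i) \<odot>\<^bsub>M\<^esub> (\<ominus>\<^bsub>M\<^esub> ?t))"
      using wc m yc t by (intro M.finsum_addf) auto
    also have "(\<Oplus>\<^bsub>M\<^esub>i\<in>I. (w i x \<otimes>\<^bsub>R\<^esub> y i) \<odot>\<^bsub>M\<^esub> (\<ominus>\<^bsub>M\<^esub> ?t)) = (\<Oplus>\<^bsub>R\<^esub>i\<in>I. w i x \<otimes>\<^bsub>R\<^esub> y i) \<odot>\<^bsub>M\<^esub> (\<ominus>\<^bsub>M\<^esub> ?t)"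
      using wc yc t by (intro finsum_smult_right[symmetric]) auto
    also have "\<dots> = \<zero>\<^bsub>M\<^esub>" using rel[OF x] t by simp
    also have "(\<Oplus>\<^bsub>M\<^esub>i\<in>I. w i x \<odot>\<^bsub>M\<^esub> m i) = x" using exp[OF x] by simp
    finally have "x = (\<Oplus>\<^bsub>M\<^esub>i\<in>I. w i x \<odot>\<^bsub>M\<^esub> ?m i)" using xM by simp
    also have "\<dots> = (\<Oplus>\<^bsub>M\<^esub>i\<in>I - {k}. w i x \<odot>\<^bsub>M\<^esub> ?m i)"
      using fin wc m' mk by (intro M.add.finprod_mono_neutral_cong_right) auto
    finally show ?thesis .
  qed
  then show "dual_expansion K (I - {k}) w ?m"
    using fin w m' by (auto simp: dual_expansion_def)
qed

text \<open>
  Take an expansion with the least number of terms. Applying the functional \<open>w\<^sub>i\<close> to it gives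
  \<open>\<Sum>\<^sub>k w\<^sub>k x \<cdot> (\<delta>\<^sub>i\<^sub>k - w\<^sub>i m\<^sub>k) = 0\<close> for all \<open>x \<in> K\<close>, and by minimality no coefficient of such a relation
  is a unit.
\<close>

lemma minimal_dual_expansion:
  assumes "dual_expansion K I w m" and K: "K \<subseteq> carrier M"
  obtains I w m where "dual_expansion K I w m"
    "\<And>i j. \<lbrakk>i \<in> I; j \<in> I\<rbrakk> \<Longrightarrow> (if i = j then \<one>\<^bsub>R\<^esub> else \<zero>\<^bsub>R\<^esub>) \<ominus>\<^bsub>R\<^esub> w i (m j) \<notin> Units R"
proof -
  obtain J where J: "\<exists>w m. dual_expansion K J w m"
    and least: "\<And>J'. (\<exists>w m. dual_expansion K J' w m) \<Longrightarrow> card J \<le> card J'"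
    using ex_has_least_nat[of "\<lambda>I. \<exists>w m. dual_expansion K I w m" I card] assms(1) by auto
  then obtain w m where e: "dual_expansion K J w m" by blast
  have fin: "finite J" and w: "\<And>i. i \<in> J \<Longrightarrow> w i \<in> carrier (dual R M)" and m: "\<And>i. i \<in> J \<Longrightarrow> m i \<in> carrier M"
    and exp: "\<And>x. x \<in> K \<Longrightarrow> x = (\<Oplus>\<^bsub>M\<^esub>i\<in>J. w i x \<odot>\<^bsub>M\<^esub> m i)"
    using e by (auto simp: dual_expansion_def)
  show thesis
  proof (rule that[OF e])
    fix i j assume i: "i \<in> J" and j: "j \<in> J"
    let ?y = "\<lambda>k. (if i = k then \<one>\<^bsub>R\<^esub> else \<zero>\<^bsub>R\<^esub>) \<ominus>\<^bsub>R\<^esub> w i (m k)"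
    have y: "?y \<in> J \<rightarrow> carrier R" using i w m by auto
    have rel: "(\<Oplus>\<^bsub>R\<^esub>k\<in>J. w k x \<otimes>\<^bsub>R\<^esub> ?y k) = \<zero>\<^bsub>R\<^esub>" if x: "x \<in> K" for x
    proof -
      have xM: "x \<in> carrier M" using x K by auto
      have wc: "w k x \<in> carrier R" if "k \<in> J" for k using that w xM by auto
      have wm: "w i (m k) \<in> carrier R" if "k \<in> J" for k using that w i m by auto
      have "(\<Oplus>\<^bsub>R\<^esub>k\<in>J. w k x \<otimes>\<^bsub>R\<^esub> ?y k) =
        (\<Oplus>\<^bsub>R\<^esub>k\<in>J. (if i = k then w k x else \<zero>\<^bsub>R\<^esub>) \<oplus>\<^bsub>R\<^esub> w i (w k x \<odot>\<^bsub>M\<^esub> (\<ominus>\<^bsub>M\<^esub> m k)))"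
        using wc wm w[OF i] m
        by (intro R.finsum_cong') (auto simp: dual_app_smult dual_app_neg a_minus_def R.r_distr)
      also have "\<dots> = (\<Oplus>\<^bsub>R\<^esub>k\<in>J. if i = k then w k x else \<zero>\<^bsub>R\<^esub>) \<oplus>\<^bsub>R\<^esub> (\<Oplus>\<^bsub>R\<^esub>k\<in>J. w i (w k x \<odot>\<^bsub>M\<^esub> (\<ominus>\<^bsub>M\<^esub> m k)))"
        using wc w[OF i] m by (intro R.finsum_addf) auto
      also have "(\<Oplus>\<^bsub>R\<^esub>k\<in>J. if i = k then w k x else \<zero>\<^bsub>R\<^esub>) = w i x"
        using i fin wc by (intro R.finsum_singleton) auto
      also have "(\<Oplus>\<^bsub>R\<^esub>k\<in>J. w i (w k x \<odot>\<^bsub>M\<^esub> (\<ominus>\<^bsub>M\<^esub> m k))) = w i (\<Oplus>\<^bsub>M\<^esub>k\<in>J. w k x \<odot>\<^bsub>M\<^esub> (\<ominus>\<^bsub>M\<^esub> m k))"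
        using w[OF i] wc m by (intro dual_app_finsum[symmetric]) auto
      also have "(\<Oplus>\<^bsub>M\<^esub>k\<in>J. w k x \<odot>\<^bsub>M\<^esub> (\<ominus>\<^bsub>M\<^esub> m k)) = (\<Oplus>\<^bsub>M\<^esub>k\<in>J. \<ominus>\<^bsub>M\<^esub> (w k x \<odot>\<^bsub>M\<^esub> m k))"
        using wc m by (intro M.finsum_cong') (auto simp: smult_neg)
      also have "\<dots> = \<ominus>\<^bsub>M\<^esub> x"
        using wc m finsum_neg[of "\<lambda>k. w k x \<odot>\<^bsub>M\<^esub> m k" J] exp[OF x] by simp
      also have "w i x \<oplus>\<^bsub>R\<^esub> w i (\<ominus>\<^bsub>M\<^esub> x) = \<zero>\<^bsub>R\<^esub>"
        using w[OF i] xM by (simp add: dual_app_neg R.r_neg)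
      finally show ?thesis .
    qed
    show "?y j \<notin> Units R"
    proof
      assume "?y j \<in> Units R"
      then obtain m' where "dual_expansion K (J - {j}) w m'"
        using dual_expansion_remove[OF e K j y _ rel] by blast
      then have "card J \<le> card (J - {j})" using least by blast
      then show False using fin j by (metis card_Diff1_less not_le)
    qed
  qed
qed

lemma ideal_closed:
  assumes "ideal I R"
  shows "\<lbrakk>a \<in> I; b \<in> I\<rbrakk> \<Longrightarrow> a \<oplus>\<^bsub>R\<^esub> b \<in> I"
    and "a \<in> I \<Longrightarrow> \<ominus>\<^bsub>R\<^esub> a \<in> I"
    and "\<lbrakk>a \<in> I; x \<in> carrier R\<rbrakk> \<Longrightarrow> x \<otimes>\<^bsub>R\<^esub> a \<in> I"
    and "\<lbrakk>a \<in> I; x \<in> carrier R\<rbrakk> \<Longrightarrow> a \<otimes>\<^bsub>R\<^esub> x \<in> I"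
    and "\<zero>\<^bsub>R\<^esub> \<in> I"
proof -
  note s = ideal.axioms(1)[OF assms]
  show "\<lbrakk>a \<in> I; b \<in> I\<rbrakk> \<Longrightarrow> a \<oplus>\<^bsub>R\<^esub> b \<in> I" by (rule additive_subgroup.a_closed[OF s])
  show l: "\<lbrakk>a \<in> I; x \<in> carrier R\<rbrakk> \<Longrightarrow> x \<otimes>\<^bsub>R\<^esub> a \<in> I" for x by (rule ideal.I_l_closed[OF assms])
  show "\<lbrakk>a \<in> I; x \<in> carrier R\<rbrakk> \<Longrightarrow> a \<otimes>\<^bsub>R\<^esub> x \<in> I" by (rule ideal.I_r_closed[OF assms])
  show "\<zero>\<^bsub>R\<^esub> \<in> I" by (rule additive_subgroup.zero_closed[OF s])
  show "\<ominus>\<^bsub>R\<^esub> a \<in> I" if "a \<in> I"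
    using l[OF that, of "\<ominus>\<^bsub>R\<^esub> \<one>\<^bsub>R\<^esub>"] subsetD[OF additive_subgroup.a_subset[OF s] that]
    by (simp add: R.l_minus)
qed

text \<open>
  Gaussian elimination on the matrix \<open>w\<^sub>i m\<^sub>j\<close>, which is invertible modulo the ideal of non-units. The
  induction makes the columns in a growing set \<open>S\<close> exact. To clear the column \<open>p\<close>, normalize \<open>w\<^sub>p\<close> by
  the inverse \<open>u\<close> of its pivot and subtract \<open>w\<^sub>p \<cdot> u \<cdot> w\<^sub>i m\<^sub>p\<close> from every other \<open>w\<^sub>i\<close>. This
  functional takes values in the ideal of non-units, because it is a multiple of \<open>w\<^sub>i m\<^sub>p\<close>, so the
  diagonal entries stay units and the others stay non-units. It vanishes on \<open>m\<^sub>j\<close> for \<open>j \<in> S\<close>, as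
  \<open>w\<^sub>p\<close> does, so the columns in \<open>S\<close> are kept.
\<close>

lemma biorthogonalize_functionals:
  assumes J: "ideal (carrier R - Units R) R"
    and fin: "finite I" and w: "w \<in> I \<rightarrow> carrier (dual R M)" and m: "m \<in> I \<rightarrow> carrier M"
    and diag: "\<And>i. i \<in> I \<Longrightarrow> w i (m i) \<in> Units R"
    and off: "\<And>i j. \<lbrakk>i \<in> I; j \<in> I; i \<noteq> j\<rbrakk> \<Longrightarrow> w i (m j) \<notin> Units R"
  obtains v where "v \<in> I \<rightarrow> carrier (dual R M)"
    "\<And>i j. \<lbrakk>i \<in> I; j \<in> I\<rbrakk> \<Longrightarrow> v i (m j) = (if i = j then \<one>\<^bsub>R\<^esub> else \<zero>\<^bsub>R\<^esub>)"
proof -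
  have cancel: "(a \<ominus>\<^bsub>R\<^esub> b) \<ominus>\<^bsub>R\<^esub> (\<ominus>\<^bsub>R\<^esub> b) = a" if "a \<in> carrier R" "b \<in> carrier R" for a b
    using that by (simp add: a_minus_def R.a_assoc R.l_neg)
  note J_closed = ideal_closed[OF J]
  have mc: "m i \<in> carrier M" if "i \<in> I" for i using that m by auto
  have "\<exists>v. v \<in> I \<rightarrow> carrier (dual R M) \<and> (\<forall>i\<in>I. v i (m i) \<in> Units R) \<and>
    (\<forall>i\<in>I. \<forall>j\<in>I. i \<noteq> j \<longrightarrow> v i (m j) \<notin> Units R) \<and>
    (\<forall>i\<in>I. \<forall>j\<in>S. v i (m j) = (if i = j then \<one>\<^bsub>R\<^esub> else \<zero>\<^bsub>R\<^esub>))" if "S \<subseteq> I" for S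
    using finite_subset[OF that fin] that
  proof (induction S)
    case empty
    then show ?case using w diag off by auto
  next
    case (insert p S)
    then obtain v where v': "v \<in> I \<rightarrow> carrier (dual R M)" "\<forall>i\<in>I. v i (m i) \<in> Units R"
      "\<forall>i\<in>I. \<forall>j\<in>I. i \<noteq> j \<longrightarrow> v i (m j) \<notin> Units R"
      "\<forall>i\<in>I. \<forall>j\<in>S. v i (m j) = (if i = j then \<one>\<^bsub>R\<^esub> else \<zero>\<^bsub>R\<^esub>)"
      by blast
    have v: "\<And>i. i \<in> I \<Longrightarrow> v i \<in> carrier (dual R M)"
      and diag: "\<And>i. i \<in> I \<Longrightarrow> v i (m i) \<in> Units R"
      and off: "\<And>i j. \<lbrakk>i \<in> I; j \<in> I; i \<noteq> j\<rbrakk> \<Longrightarrow> v i (m j) \<notin> Units R"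
      and S: "\<And>i j. \<lbrakk>i \<in> I; j \<in> S\<rbrakk> \<Longrightarrow> v i (m j) = (if i = j then \<one>\<^bsub>R\<^esub> else \<zero>\<^bsub>R\<^esub>)"
      using v' by blast+
    have p: "p \<in> I" "p \<notin> S" and SI: "\<And>j. j \<in> S \<Longrightarrow> j \<in> I" using insert by auto
    have vc: "v i (m j) \<in> carrier R" if "i \<in> I" "j \<in> I" for i j using that v mc by auto
    define u where "u = inv\<^bsub>R\<^esub> v p (m p)"
    have u: "u \<in> carrier R" "v p (m p) \<otimes>\<^bsub>R\<^esub> u = \<one>\<^bsub>R\<^esub>" "u \<in> Units R"
      using diag[OF p(1)] by (auto simp: u_def)
    have "\<exists>t\<in>carrier (dual R M). \<forall>j\<in>I. t (m j) =
      (if i = p then v p (m j) \<otimes>\<^bsub>R\<^esub> u else v i (m j) \<ominus>\<^bsub>R\<^esub> v p (m j) \<otimes>\<^bsub>R\<^esub> (u \<otimes>\<^bsub>R\<^esub> v i (m p)))" if i: "i \<in> I" for i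
    proof (cases "i = p")
      case True
      then show ?thesis using dual_scale[OF v[OF p(1)] u(1)] mc by (metis (full_types))
    next
      case False
      obtain t where "t \<in> carrier (dual R M)"
        "\<And>x. x \<in> carrier M \<Longrightarrow> t x = v i x \<ominus>\<^bsub>R\<^esub> v p x \<otimes>\<^bsub>R\<^esub> (u \<otimes>\<^bsub>R\<^esub> v i (m p))"
        using dual_diff_scale[OF v[OF i] v[OF p(1)], of "u \<otimes>\<^bsub>R\<^esub> v i (m p)"] u vc[OF i p(1)] by auto
      then show ?thesis using False mc by auto
    qed
    then obtain t where t: "\<And>i. i \<in> I \<Longrightarrow> t i \<in> carrier (dual R M)"
      and tp: "\<And>j. j \<in> I \<Longrightarrow> t p (m j) = v p (m j) \<otimes>\<^bsub>R\<^esub> u"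
      and ti: "\<And>i j. \<lbrakk>i \<in> I; j \<in> I; i \<noteq> p\<rbrakk> \<Longrightarrow>
        t i (m j) = v i (m j) \<ominus>\<^bsub>R\<^esub> v p (m j) \<otimes>\<^bsub>R\<^esub> (u \<otimes>\<^bsub>R\<^esub> v i (m p))"
      using p(1) by metis
    \<comment> \<open>The corrections are multiples of the off-diagonal entry \<open>v i (m p)\<close>.\<close>
    have corr: "\<ominus>\<^bsub>R\<^esub> (v p (m j) \<otimes>\<^bsub>R\<^esub> (u \<otimes>\<^bsub>R\<^esub> v i (m p))) \<in> carrier R - Units R"
      if "i \<in> I" "i \<noteq> p" "j \<in> I" for i j
      using that off[of i p] vc p u J_closed(3)[of "v i (m p)" "v p (m j) \<otimes>\<^bsub>R\<^esub> u"]
      by (intro J_closed(2)) (simp add: R.m_assoc)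
    have "t i (m i) \<in> Units R" if i: "i \<in> I" for i
    proof (cases "i = p")
      case True
      then show ?thesis using tp[OF p(1)] u by simp
    next
      case False
      let ?c = "\<ominus>\<^bsub>R\<^esub> (v p (m i) \<otimes>\<^bsub>R\<^esub> (u \<otimes>\<^bsub>R\<^esub> v i (m p)))"
      have c: "?c \<in> carrier R - Units R" by (rule corr[OF i False i])
      show ?thesis
      proof (rule ccontr)
        assume "t i (m i) \<notin> Units R"
        then have "t i (m i) \<in> carrier R - Units R" using t i mc by auto
        from J_closed(1)[OF this J_closed(2)[OF c]] have "t i (m i) \<ominus>\<^bsub>R\<^esub> ?c \<notin> Units R"
          by (simp add: a_minus_def)
        moreover have "t i (m i) \<ominus>\<^bsub>R\<^esub> ?c = v i (m i)"
          unfolding ti[OF i i False] using vc[OF i i] vc[OF p(1) i] vc[OF i p(1)] u(1)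
          by (intro cancel R.m_closed)
        ultimately show False using diag[OF i] by simp
      qed
    qed
    moreover have "t i (m j) \<notin> Units R" if ij: "i \<in> I" "j \<in> I" "i \<noteq> j" for i j
    proof (cases "i = p")
      case True
      then show ?thesis using tp[OF ij(2)] off[OF ij] vc[OF ij(1,2)] u J_closed(4)[of "v p (m j)" u] by simp
    next
      case False
      have "v i (m j) \<in> carrier R - Units R" using off[OF ij] vc[OF ij(1,2)] by blast
      from J_closed(1)[OF this corr[OF ij(1) False ij(2)]] show ?thesis
        unfolding ti[OF ij(1,2) False] a_minus_def by blast
    qed
    moreover have "t i (m j) = (if i = j then \<one>\<^bsub>R\<^esub> else \<zero>\<^bsub>R\<^esub>)" if i: "i \<in> I" and j: "j \<in> insert p S" for i j
    proof (cases "j = p")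
      case True
      show ?thesis
      proof (cases "i = p")
        case True
        then show ?thesis using \<open>j = p\<close> tp[OF p(1)] u by simp
      next
        case False
        have "v p (m p) \<otimes>\<^bsub>R\<^esub> (u \<otimes>\<^bsub>R\<^esub> v i (m p)) = v i (m p)"
          using u vc[OF p(1) p(1)] vc[OF i p(1)] by (simp add: R.m_assoc[symmetric])
        then show ?thesis
          using False \<open>j = p\<close> ti[OF i p(1) False] vc[OF i p(1)] by (simp add: a_minus_def R.r_neg)
      qed
    next
      case False
      then have jS: "j \<in> S" using j by simp
      then have "p \<noteq> j" using p by auto
      then have vp: "v p (m j) = \<zero>\<^bsub>R\<^esub>" using S[OF p(1) jS] by simp
      show ?thesis
      proof (cases "i = p")
        case True
        then show ?thesis using tp[OF SI[OF jS]] vp u(1) \<open>p \<noteq> j\<close> by simp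
      next
        case False
        have "t i (m j) = v i (m j) \<ominus>\<^bsub>R\<^esub> \<zero>\<^bsub>R\<^esub>"
          using ti[OF i SI[OF jS] False] vp u(1) vc[OF i p(1)] by simp
        also have "\<dots> = v i (m j)" using vc[OF i SI[OF jS]] by (simp add: a_minus_def)
        finally show ?thesis using S[OF i jS] by simp
      qed
    qed
    ultimately show ?case using t by (intro exI[of _ t]) auto
  qed
  from this[OF subset_refl] obtain v where "v \<in> I \<rightarrow> carrier (dual R M)"
    and "\<forall>i\<in>I. \<forall>j\<in>I. v i (m j) = (if i = j then \<one>\<^bsub>R\<^esub> else \<zero>\<^bsub>R\<^esub>)"
    by (elim exE conjE)
  then show thesis by (intro that[of v]) simp_all
qed

text \<open>
  For a minimal expansion the matrix \<open>w\<^sub>i m\<^sub>j\<close> is congruent to the identity modulo the non-units, so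
  there are functionals \<open>v\<^sub>i\<close> dual to the \<open>m\<^sub>j\<close>. Applying \<open>v\<^sub>i\<close> to the expansion of \<open>x \<in> K\<close> shows
  \<open>v\<^sub>i x = w\<^sub>i x\<close>, so \<open>x\<close> is in the span of the \<open>m\<^sub>j\<close>.
\<close>

lemma finite_free_direct_summand_of_dual_expansion:
  assumes J: "local_ring R" and e: "dual_expansion K I w m" and K: "K \<subseteq> carrier M"
  shows "\<exists>F\<in>finite_free_direct_summands R M. K \<subseteq> F"
proof -
  have J: "ideal (carrier R - Units R) R" using J by (simp add: local_ring_def)
  note J_closed = ideal_closed[OF J]
  obtain I w m where e: "dual_expansion K I w m"
    and nonunit: "\<And>i j. \<lbrakk>i \<in> I; j \<in> I\<rbrakk> \<Longrightarrow> (if i = j then \<one>\<^bsub>R\<^esub> else \<zero>\<^bsub>R\<^esub>) \<ominus>\<^bsub>R\<^esub> w i (m j) \<notin> Units R"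
    using minimal_dual_expansion[OF e K] by blast
  have fin: "finite I" and w: "\<And>i. i \<in> I \<Longrightarrow> w i \<in> carrier (dual R M)" and m: "\<And>i. i \<in> I \<Longrightarrow> m i \<in> carrier M"
    and exp: "\<And>x. x \<in> K \<Longrightarrow> x = (\<Oplus>\<^bsub>M\<^esub>i\<in>I. w i x \<odot>\<^bsub>M\<^esub> m i)"
    using e by (auto simp: dual_expansion_def)
  have wm: "w i (m j) \<in> carrier R" if "i \<in> I" "j \<in> I" for i j using that w m by auto
  have "w i (m i) \<in> Units R" if i: "i \<in> I" for i
  proof (rule ccontr)
    assume "w i (m i) \<notin> Units R"
    then have "w i (m i) \<in> carrier R - Units R" "\<one>\<^bsub>R\<^esub> \<ominus>\<^bsub>R\<^esub> w i (m i) \<in> carrier R - Units R"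
      using nonunit[OF i i] wm[OF i i] by auto
    from J_closed(1)[OF this] show False
      using wm[OF i i] by (simp add: a_minus_def R.a_lcomm R.r_neg)
  qed
  moreover have "w i (m j) \<notin> Units R" if ij: "i \<in> I" "j \<in> I" "i \<noteq> j" for i j
    using nonunit[OF ij(1,2)] ij(3) wm[OF ij(1,2)] J_closed(2)[of "\<ominus>\<^bsub>R\<^esub> w i (m j)"]
    by (auto simp: a_minus_def)
  ultimately obtain v where v: "v \<in> I \<rightarrow> carrier (dual R M)"
    and vm: "\<And>i j. \<lbrakk>i \<in> I; j \<in> I\<rbrakk> \<Longrightarrow> v i (m j) = (if i = j then \<one>\<^bsub>R\<^esub> else \<zero>\<^bsub>R\<^esub>)"
    using biorthogonalize_functionals[OF J fin, of w m] w m by blast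
  have vc: "v i \<in> carrier (dual R M)" if "i \<in> I" for i using that v by auto
  \<comment> \<open>A local ring is not the zero ring; hence the \<open>m\<^sub>j\<close> are distinct and can index the dual system.\<close>
  have one: "\<one>\<^bsub>R\<^esub> \<noteq> \<zero>\<^bsub>R\<^esub>" using J_closed(5) R.Units_one_closed by (metis DiffD2)
  have inj: "inj_on m I"
    using vm one by (intro inj_onI) metis
  let ?f = "\<lambda>b. v (inv_into I m b)"
  have f: "?f (m i) = v i" if "i \<in> I" for i using inj that by simp
  have ds: "dual_system (m ` I) ?f"
    unfolding dual_system_def using fin m vc vm f inj by (auto simp: inj_on_eq_iff)
  have "x \<in> span_of (m ` I) ?f" if x: "x \<in> K" for x
  proof -
    have xM: "x \<in> carrier M" using x K by auto
    have wx: "w i x \<in> carrier R" if "i \<in> I" for i using that w xM by auto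
    have vx: "v i x = w i x" if i: "i \<in> I" for i
    proof -
      have "v i x = v i (\<Oplus>\<^bsub>M\<^esub>j\<in>I. w j x \<odot>\<^bsub>M\<^esub> m j)" using exp[OF x] by simp
      also have "\<dots> = (\<Oplus>\<^bsub>R\<^esub>j\<in>I. v i (w j x \<odot>\<^bsub>M\<^esub> m j))"
        using vc[OF i] wx m by (intro dual_app_finsum) auto
      also have "\<dots> = (\<Oplus>\<^bsub>R\<^esub>j\<in>I. if i = j then w j x else \<zero>\<^bsub>R\<^esub>)"
        using vc[OF i] wx m vm[OF i] by (intro R.finsum_cong') (auto simp: dual_app_smult)
      also have "\<dots> = w i x"
        using i fin wx by (intro R.finsum_singleton) auto
      finally show ?thesis .
    qed
    have "(\<Oplus>\<^bsub>M\<^esub>b\<in>m ` I. ?f b x \<odot>\<^bsub>M\<^esub> b) = (\<Oplus>\<^bsub>M\<^esub>i\<in>I. ?f (m i) x \<odot>\<^bsub>M\<^esub> m i)"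
      using inj f vc m xM by (intro M.finsum_reindex) auto
    also have "\<dots> = (\<Oplus>\<^bsub>M\<^esub>i\<in>I. w i x \<odot>\<^bsub>M\<^esub> m i)"
      using f vx wx m by (intro M.finsum_cong') auto
    finally show ?thesis using exp[OF x] xM by (simp add: span_of_def)
  qed
  then show ?thesis using span_of_finite_free_direct_summand[OF ds] by blast
qed

text \<open>
  Every finite subset of \<open>M\<close> lies in a finite free direct summand. A summand that contains bases of
  two others contains both of them, hence directedness.
\<close>

lemma limit_of_finite_free_direct_summandsI:
  assumes "local_ring R" and single: "\<And>x. x \<in> carrier M \<Longrightarrow> \<exists>\<phi>. finite_rank \<phi> \<and> \<phi> x = x"
  shows "limit_of_finite_free_direct_summands R M"
proof -
  have cover: "\<exists>F\<in>finite_free_direct_summands R M. K \<subseteq> F" if K: "finite K" "K \<subseteq> carrier M" for K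
  proof -
    obtain \<phi> where \<phi>: "finite_rank \<phi>" "\<And>x. x \<in> K \<Longrightarrow> \<phi> x = x"
      using finite_rank_fixes_finite_set[OF single K] by blast
    then obtain n :: nat and w m where "w \<in> {..<n} \<rightarrow> carrier (dual R M)" "m \<in> {..<n} \<rightarrow> carrier M"
      and eq: "\<And>x. x \<in> carrier M \<Longrightarrow> \<phi> x = (\<Oplus>\<^bsub>M\<^esub>i\<in>{..<n}. w i x \<odot>\<^bsub>M\<^esub> m i)"
      by (auto simp: finite_rank_def)
    moreover have "x = (\<Oplus>\<^bsub>M\<^esub>i\<in>{..<n}. w i x \<odot>\<^bsub>M\<^esub> m i)" if "x \<in> K" for x
      using eq[of x] \<phi>(2)[OF that] K(2) that by auto
    ultimately have "dual_expansion K {..<n} w m"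
      by (simp add: dual_expansion_def)
    then show ?thesis using finite_free_direct_summand_of_dual_expansion[OF assms(1) _ K(2)] by blast
  qed
  have sub: "submodule F R M" if "F \<in> finite_free_direct_summands R M" for F
    using that by (simp add: finite_free_direct_summands_def direct_summand_def)
  have "\<exists>H\<in>finite_free_direct_summands R M. F \<subseteq> H \<and> G \<subseteq> H"
    if FG: "F \<in> finite_free_direct_summands R M" "G \<in> finite_free_direct_summands R M" for F G
  proof -
    obtain B f where B: "dual_system B f" "F = span_of B f"
      using finite_free_direct_summand_dual_system[OF FG(1)] by blast
    obtain C g where C: "dual_system C g" "G = span_of C g"
      using finite_free_direct_summand_dual_system[OF FG(2)] by blast
    obtain H where H: "H \<in> finite_free_direct_summands R M" "B \<union> C \<subseteq> H"
      using cover[of "B \<union> C"] B C by (auto simp: dual_system_def)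
    have "span_of A h \<subseteq> H" if "dual_system A h" "A \<subseteq> H" for A h
      using span_of_least[OF that(1) sub[OF H(1)] that(2)] .
    then show ?thesis using H B C by blast
  qed
  moreover have "\<Union>(finite_free_direct_summands R M) = carrier M"
  proof
    show "\<Union>(finite_free_direct_summands R M) \<subseteq> carrier M" using submoduleD(1)[OF sub] by blast
    show "carrier M \<subseteq> \<Union>(finite_free_direct_summands R M)"
    proof
      fix x assume "x \<in> carrier M"
      then show "x \<in> \<Union>(finite_free_direct_summands R M)" using cover[of "{x}"] by auto
    qed
  qed
  ultimately show ?thesis by (auto simp: limit_of_finite_free_direct_summands_def)
qed

end

section \<open>Injectivity of the natural maps yields endomorphisms fixing an element\<close>

text \<open>
  The cyclic right module \<open>R / I\<close> with its projection \<open>q\<close>. Its elements are encoded in the type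
  \<open>(nat \<Rightarrow> 'r) set\<close> by letting the coset of \<open>r\<close> constrain only the value of a function at \<open>0\<close>.
\<close>

lemma cyclic_right_module:
  fixes R :: "('r, 'k) ring_scheme"
  assumes "ring R" and I: "I \<subseteq> carrier R" "\<zero>\<^bsub>R\<^esub> \<in> I"
    and add: "\<And>r s. \<lbrakk>r \<in> I; s \<in> I\<rbrakk> \<Longrightarrow> r \<oplus>\<^bsub>R\<^esub> s \<in> I"
    and mult: "\<And>r a. \<lbrakk>r \<in> I; a \<in> carrier R\<rbrakk> \<Longrightarrow> r \<otimes>\<^bsub>R\<^esub> a \<in> I"
  obtains N :: "('r, (nat \<Rightarrow> 'r) set) module" and q where "right_module R N" "carrier N = q ` carrier R"
    "\<And>r s. \<lbrakk>r \<in> carrier R; s \<in> carrier R\<rbrakk> \<Longrightarrow> q (r \<oplus>\<^bsub>R\<^esub> s) = q r \<oplus>\<^bsub>N\<^esub> q s"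
    "\<And>r a. \<lbrakk>r \<in> carrier R; a \<in> carrier R\<rbrakk> \<Longrightarrow> q (r \<otimes>\<^bsub>R\<^esub> a) = a \<odot>\<^bsub>N\<^esub> q r"
    "\<And>r. r \<in> carrier R \<Longrightarrow> q r = \<zero>\<^bsub>N\<^esub> \<longleftrightarrow> r \<in> I"
proof -
  interpret R: ring R by fact
  have I': "r \<in> carrier R" if "r \<in> I" for r using that I by auto
  have neg: "\<ominus>\<^bsub>R\<^esub> r \<in> I" if "r \<in> I" for r
    using mult[OF that, of "\<ominus>\<^bsub>R\<^esub> \<one>\<^bsub>R\<^esub>"] I'[OF that] by (simp add: R.r_minus)
  define q where "q r = {f :: nat \<Rightarrow> 'r. f 0 \<in> carrier R \<and> f 0 \<ominus>\<^bsub>R\<^esub> r \<in> I}" for r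
  have q_eq: "q r = q s \<longleftrightarrow> r \<ominus>\<^bsub>R\<^esub> s \<in> I" if r: "r \<in> carrier R" and s: "s \<in> carrier R" for r s
  proof
    assume "q r = q s"
    moreover have "(\<lambda>_. r) \<in> q r" using r I by (simp add: q_def a_minus_def R.r_neg)
    ultimately show "r \<ominus>\<^bsub>R\<^esub> s \<in> I" by (simp add: q_def)
  next
    assume d: "r \<ominus>\<^bsub>R\<^esub> s \<in> I"
    have "s \<ominus>\<^bsub>R\<^esub> r = \<ominus>\<^bsub>R\<^esub> (r \<ominus>\<^bsub>R\<^esub> s)"
      using r s by (simp add: a_minus_def R.minus_add R.a_comm)
    then have d': "s \<ominus>\<^bsub>R\<^esub> r \<in> I" using neg[OF d] by simp
    have sub: "q t \<subseteq> q u" if tu: "t \<in> carrier R" "u \<in> carrier R" "t \<ominus>\<^bsub>R\<^esub> u \<in> I" for t u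
    proof -
      have "a \<ominus>\<^bsub>R\<^esub> u = (a \<ominus>\<^bsub>R\<^esub> t) \<oplus>\<^bsub>R\<^esub> (t \<ominus>\<^bsub>R\<^esub> u)" if "a \<in> carrier R" for a
        using that tu by (simp add: a_minus_def R.a_assoc R.r_neg1)
      then show ?thesis using add[OF _ tu(3)] by (auto simp: q_def)
    qed
    show "q r = q s" by (intro equalityI sub r s d d')
  qed
  \<comment> \<open>The operations are defined by representatives; \<open>qa\<close> and \<open>qm\<close> show that the choice is immaterial.\<close>
  define rep where "rep C = (SOME r. r \<in> carrier R \<and> q r = C)" for C
  have rep: "rep (q r) \<in> carrier R" "q (rep (q r)) = q r" if "r \<in> carrier R" for r
    using someI[of "\<lambda>s. s \<in> carrier R \<and> q s = q r" r] that by (auto simp: rep_def)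
  have rep': "rep (q r) \<ominus>\<^bsub>R\<^esub> r \<in> I" if "r \<in> carrier R" for r
    using q_eq[OF rep(1)[OF that] that] rep(2)[OF that] by simp
  define N :: "('r, (nat \<Rightarrow> 'r) set) module" where
    "N = \<lparr>carrier = q ` carrier R, monoid.mult = undefined, one = undefined, ring.zero = q \<zero>\<^bsub>R\<^esub>,
      add = (\<lambda>C D. q (rep C \<oplus>\<^bsub>R\<^esub> rep D)), smult = (\<lambda>a C. q (rep C \<otimes>\<^bsub>R\<^esub> a))\<rparr>"
  have qa: "q r \<oplus>\<^bsub>N\<^esub> q s = q (r \<oplus>\<^bsub>R\<^esub> s)" if rs: "r \<in> carrier R" "s \<in> carrier R" for r s
  proof -
    have "(rep (q r) \<oplus>\<^bsub>R\<^esub> rep (q s)) \<ominus>\<^bsub>R\<^esub> (r \<oplus>\<^bsub>R\<^esub> s) = (rep (q r) \<ominus>\<^bsub>R\<^esub> r) \<oplus>\<^bsub>R\<^esub> (rep (q s) \<ominus>\<^bsub>R\<^esub> s)"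
      using rs rep by (simp add: a_minus_def R.minus_add R.a_ac)
    also have "\<dots> \<in> I" using rs rep' add by simp
    finally show ?thesis using rs rep by (simp add: N_def q_eq)
  qed
  have qm: "a \<odot>\<^bsub>N\<^esub> q r = q (r \<otimes>\<^bsub>R\<^esub> a)" if ra: "r \<in> carrier R" "a \<in> carrier R" for r a
  proof -
    have "rep (q r) \<otimes>\<^bsub>R\<^esub> a \<ominus>\<^bsub>R\<^esub> r \<otimes>\<^bsub>R\<^esub> a = (rep (q r) \<ominus>\<^bsub>R\<^esub> r) \<otimes>\<^bsub>R\<^esub> a"
      using ra rep by (simp add: a_minus_def R.l_distr R.l_minus)
    also have "\<dots> \<in> I" using ra rep' mult by simp
    finally show ?thesis using ra rep by (simp add: N_def q_eq)
  qed
  have N: "carrier N = q ` carrier R" "\<zero>\<^bsub>N\<^esub> = q \<zero>\<^bsub>R\<^esub>" by (simp_all add: N_def)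
  have "abelian_group N"
  proof (rule abelian_groupI)
    fix x assume "x \<in> carrier N"
    then obtain r where r: "r \<in> carrier R" "x = q r" using N by auto
    then show "\<exists>y\<in>carrier N. y \<oplus>\<^bsub>N\<^esub> x = \<zero>\<^bsub>N\<^esub>"
      using N by (intro bexI[of _ "q (\<ominus>\<^bsub>R\<^esub> r)"]) (auto simp: qa R.l_neg)
  qed (auto simp: N qa R.a_ac)
  moreover have "right_module_axioms R N"
    by unfold_locales (auto simp: N qa qm R.r_distr R.l_distr R.m_assoc)
  ultimately have "right_module R N" using R.ring_axioms by (simp add: right_module_def)
  moreover have "q r = \<zero>\<^bsub>N\<^esub> \<longleftrightarrow> r \<in> I" if "r \<in> carrier R" for r
    using that by (simp add: N q_eq) (simp add: a_minus_def)
  ultimately show thesis using that[of N q] N qa qm by auto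
qed

context left_module
begin

lemma dual_zero:
  obtains w where "w \<in> carrier (dual R M)" "\<And>x. x \<in> carrier M \<Longrightarrow> w x = \<zero>\<^bsub>R\<^esub>"
proof
  show "(\<lambda>x\<in>carrier M. \<zero>\<^bsub>R\<^esub>) \<in> carrier (dual R M)"
    by (auto simp: dual_def)
qed auto

text \<open>
  Let \<open>I\<close> be the right ideal of all \<open>w x\<close> with \<open>w \<in> M\<^sup>*\<close>, and \<open>N = R / I\<close>. The natural map kills
  \<open>1 \<otimes> x\<close>, which is therefore zero by injectivity. The isomorphism of \<open>(R / I) \<otimes> M\<close> with \<open>M / I M\<close> then gives
  \<open>x \<in> I M = {\<phi> x | \<phi> of finite rank}\<close>. To avoid the quotient \<open>M / I M\<close>, the proof chooses
  representatives in \<open>R\<close> of the elements of \<open>N\<close>: the resulting homomorphism \<open>h\<close> from the free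
  abelian group to \<open>M\<close> sends the defining relations of the tensor product into \<open>I M\<close>.
\<close>

lemma finite_rank_fixes_of_Mittag_Leffler:
  assumes mittag: "flat_strict_Mittag_Leffler TYPE((nat \<Rightarrow> 'r) set) R M" and x: "x \<in> carrier M"
  shows "\<exists>\<phi>. finite_rank \<phi> \<and> \<phi> x = x"
proof -
  define I where "I = {w x | w. w \<in> carrier (dual R M)}"
  have Isub: "I \<subseteq> carrier R" using x by (auto simp: I_def)
  have I0: "\<zero>\<^bsub>R\<^esub> \<in> I" using dual_zero x by (metis (mono_tags, lifting) I_def mem_Collect_eq)
  have Iadd: "r \<oplus>\<^bsub>R\<^esub> s \<in> I" if rs: "r \<in> I" "s \<in> I" for r s
  proof -
    obtain v w where v: "v \<in> carrier (dual R M)" "w \<in> carrier (dual R M)" "r = v x" "s = w x"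
      using rs by (auto simp: I_def)
    have "v \<oplus>\<^bsub>dual R M\<^esub> w \<in> carrier (dual R M)"
      by (rule dual_closed(1)[OF left_module_axioms v(1,2)])
    moreover have "(v \<oplus>\<^bsub>dual R M\<^esub> w) x = r \<oplus>\<^bsub>R\<^esub> s" using x v by (simp add: dual_def)
    ultimately show ?thesis unfolding I_def by (metis (mono_tags, lifting) mem_Collect_eq)
  qed
  have Imult: "r \<otimes>\<^bsub>R\<^esub> a \<in> I" if ra: "r \<in> I" "a \<in> carrier R" for r a
  proof -
    obtain w where w: "w \<in> carrier (dual R M)" "r = w x" using ra by (auto simp: I_def)
    obtain u where "u \<in> carrier (dual R M)" "u x = w x \<otimes>\<^bsub>R\<^esub> a"
      using dual_scale[OF w(1) ra(2)] x by metis
    then show ?thesis using w(2) unfolding I_def by (metis (mono_tags, lifting) mem_Collect_eq)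
  qed
  obtain N :: "('r, (nat \<Rightarrow> 'r) set) module" and q where N: "right_module R N"
    and carrier_N: "carrier N = q ` carrier R"
    and qa: "\<And>r s. \<lbrakk>r \<in> carrier R; s \<in> carrier R\<rbrakk> \<Longrightarrow> q (r \<oplus>\<^bsub>R\<^esub> s) = q r \<oplus>\<^bsub>N\<^esub> q s"
    and qm: "\<And>r a. \<lbrakk>r \<in> carrier R; a \<in> carrier R\<rbrakk> \<Longrightarrow> q (r \<otimes>\<^bsub>R\<^esub> a) = a \<odot>\<^bsub>N\<^esub> q r"
    and q0: "\<And>r. r \<in> carrier R \<Longrightarrow> q r = \<zero>\<^bsub>N\<^esub> \<longleftrightarrow> r \<in> I"
    by (rule cyclic_right_module[OF R.ring_axioms Isub I0 Iadd Imult]) blast+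
  interpret N: right_module R N by fact
  have q1: "q \<one>\<^bsub>R\<^esub> \<in> carrier N" using carrier_N by auto
  let ?F = "tensor_free N M"
  define K where "K = generate ?F (tensor_rels R N M)"
  interpret F: comm_group ?F by (rule abelian_free_Abelian_group)
  have K: "subgroup K ?F"
    unfolding K_def by (rule F.generate_is_subgroup[OF tensor_rels_subset[OF N left_module_axioms]])
  \<comment> \<open>Every functional sends \<open>x\<close> into \<open>I\<close>, so the natural map kills \<open>1 \<otimes> x\<close> in \<open>(R / I) \<otimes> M\<close>.\<close>
  have mem: "frag_of (q \<one>\<^bsub>R\<^esub>, x) \<in> K"
  proof -
    have c: "frag_of (q \<one>\<^bsub>R\<^esub>, x) \<in> carrier ?F" "0 \<in> carrier ?F" using q1 x by auto
    have "w x \<odot>\<^bsub>N\<^esub> q \<one>\<^bsub>R\<^esub> = \<zero>\<^bsub>N\<^esub>" if w: "w \<in> carrier (dual R M)" for w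
      using qm[of "\<one>\<^bsub>R\<^esub>" "w x"] q0[of "w x"] w x by (auto simp: I_def)
    then have "pre_tensor_map R N M (frag_of (q \<one>\<^bsub>R\<^esub>, x)) = pre_tensor_map R N M 0"
      unfolding pre_tensor_map_frag_of[OF N q1 x] by (auto simp: pre_tensor_map_def intro!: restrict_ext)
    then have "tensor_map R N M (K #>\<^bsub>?F\<^esub> frag_of (q \<one>\<^bsub>R\<^esub>, x)) = tensor_map R N M (K #>\<^bsub>?F\<^esub> 0)"
      unfolding K_def tensor_map_coset[OF N left_module_axioms c(1)] tensor_map_coset[OF N left_module_axioms c(2)] .
    moreover have "K #>\<^bsub>?F\<^esub> c \<in> carrier (tensor R N M)" if "c \<in> carrier ?F" for c
      using that by (auto simp: tensor_def carrier_FactGroup K_def simp del: carrier_free_Abelian_group_iff)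
    ultimately have "K #>\<^bsub>?F\<^esub> frag_of (q \<one>\<^bsub>R\<^esub>, x) = K #>\<^bsub>?F\<^esub> 0"
      using mittag N c unfolding flat_strict_Mittag_Leffler_def by (auto dest!: inj_onD simp del: carrier_free_Abelian_group_iff)
    also have "K #>\<^bsub>?F\<^esub> 0 = K"
      using F.coset_mult_one[OF subgroup.subset[OF K]] by simp
    finally show ?thesis using F.rcos_self[OF c(1) K] by blast
  qed
  define rep where "rep n = (SOME r. r \<in> carrier R \<and> q r = n)" for n
  have rep: "rep n \<in> carrier R" "q (rep n) = n" if "n \<in> carrier N" for n
    using someI_ex[of "\<lambda>r. r \<in> carrier R \<and> q r = n"] that carrier_N by (auto simp: rep_def)
  have diffI: "r \<ominus>\<^bsub>R\<^esub> s \<in> I" if "q r = q s" "r \<in> carrier R" "s \<in> carrier R" for r s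
  proof -
    have "q (r \<ominus>\<^bsub>R\<^esub> s) = q s \<oplus>\<^bsub>N\<^esub> q (\<ominus>\<^bsub>R\<^esub> s)" using that qa by (simp add: a_minus_def)
    also have "\<dots> = q \<zero>\<^bsub>R\<^esub>" using that qa[of s "\<ominus>\<^bsub>R\<^esub> s"] by (simp add: R.r_neg)
    also have "\<dots> = \<zero>\<^bsub>N\<^esub>" using q0 I0 by simp
    finally show ?thesis using q0 that by simp
  qed
  \<comment> \<open>The subgroup \<open>I M\<close> of \<open>M\<close>.\<close>
  define S where "S = {\<phi> x | \<phi>. finite_rank \<phi>}"
  have SM: "y \<in> carrier M" if "y \<in> S" for y using that x finite_rank_linear(1) by (auto simp: S_def)
  have S0: "\<zero>\<^bsub>M\<^esub> \<in> S" using finite_rank_zero by (auto simp: S_def)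
  have Sadd: "y \<oplus>\<^bsub>M\<^esub> z \<in> S" if "y \<in> S" "z \<in> S" for y z
    using that finite_rank_add unfolding S_def by fastforce
  have Sneg: "\<ominus>\<^bsub>M\<^esub> y \<in> S" if "y \<in> S" for y
    using that finite_rank_neg unfolding S_def by fastforce
  have SI: "r \<odot>\<^bsub>M\<^esub> m \<in> S" if "r \<in> I" "m \<in> carrier M" for r m
    using that finite_rank_single unfolding S_def I_def by fastforce
  have "(\<lambda>p. rep (fst p) \<odot>\<^bsub>M\<^esub> snd p) ` (carrier N \<times> carrier M) \<subseteq> carrier (add_monoid M)"
    using rep(1) by auto
  then obtain h where h: "h \<in> hom ?F (add_monoid M)"
    and hf: "\<And>p. p \<in> carrier N \<times> carrier M \<Longrightarrow> h (frag_of p) = rep (fst p) \<odot>\<^bsub>M\<^esub> snd p"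
    by (rule comm_group.free_Abelian_group_universal[OF M.a_comm_group]) blast
  interpret h: group_hom ?F "add_monoid M" h
    using h M.a_group by (simp add: group_hom_def group_hom_axioms_def)
  have hd: "h (c - d) = h c \<ominus>\<^bsub>M\<^esub> h d" if "c \<in> carrier ?F" "d \<in> carrier ?F" for c d
  proof -
    have "- d \<in> carrier ?F" using that by simp
    then have "h (c + - d) = h c \<oplus>\<^bsub>M\<^esub> h (- d)" using h.hom_mult[OF that(1), of "- d"] by simp
    moreover have "h (- d) = \<ominus>\<^bsub>M\<^esub> h d" using h.hom_inv[OF that(2)] that by (simp add: a_inv_def)
    ultimately show ?thesis by (simp add: a_minus_def)
  qed
  have dc: "c - d \<in> carrier ?F" if "c \<in> carrier ?F" "d \<in> carrier ?F" for c d
    using that keys_diff[of c d] by auto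
  have fr: "frag_of (n, m) \<in> carrier ?F" "h (frag_of (n, m)) = rep n \<odot>\<^bsub>M\<^esub> m"
    if "n \<in> carrier N" "m \<in> carrier M" for n m
    using that hf by simp_all
  have rels: "h c \<in> S" if c: "c \<in> tensor_rels R N M" for c
    using c unfolding tensor_rels_def
  proof (elim UnE CollectE exE conjE)
    fix n n' m assume c: "c = frag_of (n \<oplus>\<^bsub>N\<^esub> n', m) - frag_of (n, m) - frag_of (n', m)"
      and nm: "n \<in> carrier N" "n' \<in> carrier N" "m \<in> carrier M"
    have nn: "n \<oplus>\<^bsub>N\<^esub> n' \<in> carrier N" using nm by simp
    have "h c = rep (n \<oplus>\<^bsub>N\<^esub> n') \<odot>\<^bsub>M\<^esub> m \<ominus>\<^bsub>M\<^esub> rep n \<odot>\<^bsub>M\<^esub> m \<ominus>\<^bsub>M\<^esub> rep n' \<odot>\<^bsub>M\<^esub> m"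
      using nm nn by (simp add: c hd dc fr del: carrier_free_Abelian_group_iff)
    also have "\<dots> = (rep (n \<oplus>\<^bsub>N\<^esub> n') \<ominus>\<^bsub>R\<^esub> (rep n \<oplus>\<^bsub>R\<^esub> rep n')) \<odot>\<^bsub>M\<^esub> m"
      using nm rep(1)[OF nn] rep(1)[OF nm(1)] rep(1)[OF nm(2)]
      by (simp add: a_minus_def smult_l_distr neg_smult M.minus_add M.a_ac)
    also have "\<dots> \<in> S"
      using nm nn rep qa by (intro SI diffI) auto
    finally show ?thesis .
  next
    fix n m m' assume c: "c = frag_of (n, m \<oplus>\<^bsub>M\<^esub> m') - frag_of (n, m) - frag_of (n, m')"
      and nm: "n \<in> carrier N" "m \<in> carrier M" "m' \<in> carrier M"
    have "h c = rep n \<odot>\<^bsub>M\<^esub> (m \<oplus>\<^bsub>M\<^esub> m') \<ominus>\<^bsub>M\<^esub> rep n \<odot>\<^bsub>M\<^esub> m \<ominus>\<^bsub>M\<^esub> rep n \<odot>\<^bsub>M\<^esub> m'"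
      using nm by (simp add: c hd dc fr del: carrier_free_Abelian_group_iff)
    also have "\<dots> = \<zero>\<^bsub>M\<^esub>"
      using nm rep(1)[OF nm(1)]
      by (simp add: a_minus_def smult_r_distr M.a_ac M.r_neg M.r_neg1 M.r_neg2)
    finally show ?thesis using S0 by simp
  next
    fix a n m assume c: "c = frag_of (a \<odot>\<^bsub>N\<^esub> n, m) - frag_of (n, a \<odot>\<^bsub>M\<^esub> m)"
      and nm: "a \<in> carrier R" "n \<in> carrier N" "m \<in> carrier M"
    have an: "a \<odot>\<^bsub>N\<^esub> n \<in> carrier N" using nm by simp
    have "h c = rep (a \<odot>\<^bsub>N\<^esub> n) \<odot>\<^bsub>M\<^esub> m \<ominus>\<^bsub>M\<^esub> rep n \<odot>\<^bsub>M\<^esub> (a \<odot>\<^bsub>M\<^esub> m)"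
      using nm an by (simp add: c hd dc fr del: carrier_free_Abelian_group_iff)
    also have "\<dots> = (rep (a \<odot>\<^bsub>N\<^esub> n) \<ominus>\<^bsub>R\<^esub> rep n \<otimes>\<^bsub>R\<^esub> a) \<odot>\<^bsub>M\<^esub> m"
      using nm rep(1)[OF an] rep(1)[OF nm(2)]
      by (simp add: a_minus_def smult_l_distr neg_smult smult_assoc)
    also have "\<dots> \<in> S"
      using nm an rep qm by (intro SI diffI) auto
    finally show ?thesis .
  qed
  have KS: "h c \<in> S" if "c \<in> K" for c
    using that unfolding K_def
  proof (induction rule: generate.induct)
    case one
    then show ?case using S0 h.hom_one by (simp del: one_free_Abelian_group)
  next
    case (incl c)
    then show ?case by (rule rels)
  next
    case (inv c)
    then have "c \<in> carrier ?F" using tensor_rels_subset[OF N left_module_axioms] by blast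
    then show ?case using Sneg[OF rels[OF inv]] h.hom_inv[of c] by (simp add: a_inv_def)
  next
    case (eng c d)
    then have "c \<in> carrier ?F" "d \<in> carrier ?F"
      using subsetD[OF subgroup.subset[OF K]] unfolding K_def by blast+
    then show ?case using Sadd[OF eng.IH] h.hom_mult[of c d] by simp
  qed
  \<comment> \<open>The representative chosen for the class of \<open>1\<close> differs from \<open>1\<close> by an element of \<open>I\<close>.\<close>
  have "rep (q \<one>\<^bsub>R\<^esub>) \<odot>\<^bsub>M\<^esub> x \<in> S" using KS[OF mem] fr(2)[OF q1 x] by simp
  moreover have "(\<one>\<^bsub>R\<^esub> \<ominus>\<^bsub>R\<^esub> rep (q \<one>\<^bsub>R\<^esub>)) \<odot>\<^bsub>M\<^esub> x \<in> S"
    using rep[OF q1] x by (intro SI diffI) auto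
  ultimately have "rep (q \<one>\<^bsub>R\<^esub>) \<odot>\<^bsub>M\<^esub> x \<oplus>\<^bsub>M\<^esub> (\<one>\<^bsub>R\<^esub> \<ominus>\<^bsub>R\<^esub> rep (q \<one>\<^bsub>R\<^esub>)) \<odot>\<^bsub>M\<^esub> x \<in> S" by (rule Sadd)
  also have "rep (q \<one>\<^bsub>R\<^esub>) \<odot>\<^bsub>M\<^esub> x \<oplus>\<^bsub>M\<^esub> (\<one>\<^bsub>R\<^esub> \<ominus>\<^bsub>R\<^esub> rep (q \<one>\<^bsub>R\<^esub>)) \<odot>\<^bsub>M\<^esub> x = x"
    using rep(1)[OF q1] x
    by (simp add: a_minus_def smult_l_distr neg_smult M.a_lcomm M.r_neg)
  finally show ?thesis by (auto simp: S_def)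
qed

section \<open>Directed unions of finite free direct summands\<close>

lemma finite_subset_of_summand:
  assumes L: "limit_of_finite_free_direct_summands R M" and K: "finite K" "K \<subseteq> carrier M"
  shows "\<exists>F\<in>finite_free_direct_summands R M. K \<subseteq> F"
  using K
proof (induction K)
  case empty
  then show ?case using L M.zero_closed by (auto simp: limit_of_finite_free_direct_summands_def)
next
  case (insert x K)
  then obtain F where F: "F \<in> finite_free_direct_summands R M" "K \<subseteq> F" by auto
  have "x \<in> \<Union>(finite_free_direct_summands R M)"
    using insert.prems L by (simp add: limit_of_finite_free_direct_summands_def)
  then obtain G where G: "G \<in> finite_free_direct_summands R M" "x \<in> G" by blast
  obtain H where "H \<in> finite_free_direct_summands R M" "F \<subseteq> H" "G \<subseteq> H"
    using bspec[OF bspec[OF conjunct1[OF L[unfolded limit_of_finite_free_direct_summands_def]] F(1)] G(1)]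
    by blast
  then show ?case using F G by (intro bexI[of _ H]) auto
qed

text \<open>
  Choose a finite free direct summand \<open>P\<close> with dual system \<open>(B, f)\<close> that contains all second factors
  occurring in \<open>c\<close>. Modulo the relations, \<open>n \<otimes> m = \<Sum> n \<otimes> (f b m \<cdot> b) = \<Sum> (n \<cdot> f b m) \<otimes> b\<close> for
  \<open>m \<in> P\<close>. By additivity \<open>c = \<Sum> n\<^sub>b \<otimes> b\<close>, where \<open>n\<^sub>b\<close> is the value at \<open>f b\<close> of the image of \<open>c\<close> under
  the natural map, that is, zero. The computation takes place in the free abelian group, with \<open>K\<close> the
  subgroup of relations.
\<close>

lemma tensor_relation_of_kernel:
  fixes N :: "('r, 'n, 'j) module_scheme"
  assumes N: "right_module R N" and L: "limit_of_finite_free_direct_summands R M"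
    and c: "c \<in> carrier (tensor_free N M)"
    and ker: "\<And>w. w \<in> carrier (dual R M) \<Longrightarrow> pre_tensor_map R N M c w = \<zero>\<^bsub>N\<^esub>"
  shows "c \<in> generate (tensor_free N M) (tensor_rels R N M)"
proof -
  interpret N: right_module R N by fact
  let ?F = "tensor_free N M"
  define K where "K = generate ?F (tensor_rels R N M)"
  interpret F: comm_group ?F by (rule abelian_free_Abelian_group)
  have K: "subgroup K ?F"
    unfolding K_def by (rule F.generate_is_subgroup[OF tensor_rels_subset[OF N left_module_axioms]])
  have K0: "0 \<in> K" using subgroup.one_closed[OF K] by simp
  have Kadd: "a + b \<in> K" if "a \<in> K" "b \<in> K" for a b
    using subgroup.m_closed[OF K that] by simp
  have Kneg: "- a \<in> K" if "a \<in> K" for a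
    using subgroup.m_inv_closed[OF K that] subsetD[OF subgroup.subset[OF K] that] by simp
  have Kdiff: "a - b \<in> K" if "a \<in> K" "b \<in> K" for a b
    using Kadd[OF that(1) Kneg[OF that(2)]] by simp
  have Ksum: "(\<Sum>b\<in>B. g b) \<in> K" if "\<And>b. b \<in> B \<Longrightarrow> g b \<in> K" for g and B :: "'m set"
    using that by (induction B rule: infinite_finite_induct) (auto intro: K0 Kadd)
  have rel: "r \<in> K" if "r \<in> tensor_rels R N M" for r
    using that unfolding K_def by (rule generate.incl)
  have addl: "frag_of (n \<oplus>\<^bsub>N\<^esub> n', m) - frag_of (n, m) - frag_of (n', m) \<in> K"
    if "n \<in> carrier N" "n' \<in> carrier N" "m \<in> carrier M" for n n' m
    by (rule rel) (use that in \<open>auto simp: tensor_rels_def\<close>)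
  have addr: "frag_of (n, m \<oplus>\<^bsub>M\<^esub> m') - frag_of (n, m) - frag_of (n, m') \<in> K"
    if "n \<in> carrier N" "m \<in> carrier M" "m' \<in> carrier M" for n m m'
    by (rule rel) (use that in \<open>auto simp: tensor_rels_def\<close>)
  have sm: "frag_of (a \<odot>\<^bsub>N\<^esub> n, m) - frag_of (n, a \<odot>\<^bsub>M\<^esub> m) \<in> K"
    if "a \<in> carrier R" "n \<in> carrier N" "m \<in> carrier M" for a n m
    by (rule rel) (use that in \<open>auto simp: tensor_rels_def\<close>)
  have zl: "frag_of (\<zero>\<^bsub>N\<^esub>, m) \<in> K" if "m \<in> carrier M" for m
    using Kneg[OF addl[of "\<zero>\<^bsub>N\<^esub>" "\<zero>\<^bsub>N\<^esub>" m]] that by simp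
  have zr: "frag_of (n, \<zero>\<^bsub>M\<^esub>) \<in> K" if "n \<in> carrier N" for n
    using Kneg[OF addr[of n "\<zero>\<^bsub>M\<^esub>" "\<zero>\<^bsub>M\<^esub>"]] that by simp
  have diffl: "frag_of (n \<ominus>\<^bsub>N\<^esub> n', m) - frag_of (n, m) + frag_of (n', m) \<in> K"
    if "n \<in> carrier N" "n' \<in> carrier N" "m \<in> carrier M" for n n' m
  proof -
    have "n \<ominus>\<^bsub>N\<^esub> n' \<oplus>\<^bsub>N\<^esub> n' = n"
      using that by (simp add: a_minus_def N.N.a_assoc N.N.l_neg)
    then show ?thesis using Kneg[OF addl[of "n \<ominus>\<^bsub>N\<^esub> n'" n' m]] that by (simp add: algebra_simps)
  qed
  have sumr: "frag_of (n, \<Oplus>\<^bsub>M\<^esub>b\<in>B. g b) - (\<Sum>b\<in>B. frag_of (n, g b)) \<in> K"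
    if n: "n \<in> carrier N" and B: "finite B" "g \<in> B \<rightarrow> carrier M" for n g and B :: "'m set"
    using B
  proof (induction B)
    case empty
    then show ?case using zr n by simp
  next
    case (insert b B)
    have g: "g b \<in> carrier M" "g \<in> B \<rightarrow> carrier M" using insert.prems by auto
    then have s: "(\<Oplus>\<^bsub>M\<^esub>b\<in>B. g b) \<in> carrier M" by (intro M.finsum_closed)
    show ?case
      using Kadd[OF insert.IH[OF g(2)] addr[OF n g(1) s]] insert.hyps g
      by (simp add: algebra_simps)
  qed
  note pm = pre_tensor_map_hom_pointwise[OF N left_module_axioms]
  have gh: "group_hom ?F (add_monoid N) (\<lambda>c. pre_tensor_map R N M c w)"
    if "w \<in> carrier (dual R M)" for w
    using pm[OF that] N.N.a_group by (simp add: group_hom_def group_hom_axioms_def)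
  have "snd ` Poly_Mapping.keys c \<subseteq> carrier M" using c by auto
  then obtain P where P: "P \<in> finite_free_direct_summands R M" "snd ` Poly_Mapping.keys c \<subseteq> P"
    using finite_subset_of_summand[OF L] by (meson finite_imageI finite_keys)
  obtain B f where ds: "dual_system B f" and PB: "P = span_of B f"
    using finite_free_direct_summand_dual_system[OF P(1)] by blast
  have fin: "finite B" and B: "\<And>b. b \<in> B \<Longrightarrow> b \<in> carrier M"
    and fd: "\<And>b. b \<in> B \<Longrightarrow> f b \<in> carrier (dual R M)"
    using ds by (auto simp: dual_system_def)
  have PM: "P \<subseteq> carrier M" using PB by (auto simp: span_of_def)
  have "Poly_Mapping.keys c \<subseteq> carrier N \<times> P" using c P(2) by force
  then have "Poly_Mapping.keys c \<subseteq> carrier N \<times> P \<and>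
    c - (\<Sum>b\<in>B. frag_of (pre_tensor_map R N M c (f b), b)) \<in> K"
  proof (rule free_Abelian_group_induct)
    have "pre_tensor_map R N M 0 (f b) = \<zero>\<^bsub>N\<^esub>" if "b \<in> B" for b
      using fd[OF that] by (simp add: pre_tensor_map_def)
    then show "Poly_Mapping.keys 0 \<subseteq> carrier N \<times> P \<and>
      0 - (\<Sum>b\<in>B. frag_of (pre_tensor_map R N M 0 (f b), b)) \<in> K"
      using zl B by (auto intro!: Kneg Ksum)
  next
    fix d e :: "'n \<times> 'm \<Rightarrow>\<^sub>0 int"
    assume de: "Poly_Mapping.keys d \<subseteq> carrier N \<times> P" "Poly_Mapping.keys e \<subseteq> carrier N \<times> P"
      and IHd: "Poly_Mapping.keys d \<subseteq> carrier N \<times> P \<and> d - (\<Sum>b\<in>B. frag_of (pre_tensor_map R N M d (f b), b)) \<in> K"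
      and IHe: "Poly_Mapping.keys e \<subseteq> carrier N \<times> P \<and> e - (\<Sum>b\<in>B. frag_of (pre_tensor_map R N M e (f b), b)) \<in> K"
    have dF: "d \<in> carrier ?F" "e \<in> carrier ?F" "- e \<in> carrier ?F" using de PM by auto
    let ?p = "\<lambda>c b. pre_tensor_map R N M c (f b)"
    have pd: "?p (d - e) b = ?p d b \<ominus>\<^bsub>N\<^esub> ?p e b" and pc: "?p d b \<in> carrier N" "?p e b \<in> carrier N"
      if b: "b \<in> B" for b
    proof -
      interpret g: group_hom ?F "add_monoid N" "\<lambda>c. ?p c b" by (rule gh[OF fd[OF b]])
      have "?p (d + - e) b = ?p d b \<oplus>\<^bsub>N\<^esub> ?p (- e) b" using g.hom_mult[OF dF(1,3)] by simp
      moreover have "?p (- e) b = \<ominus>\<^bsub>N\<^esub> ?p e b" using g.hom_inv[OF dF(2)] dF(2) by (simp add: a_inv_def)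
      ultimately show "?p (d - e) b = ?p d b \<ominus>\<^bsub>N\<^esub> ?p e b" by (simp add: a_minus_def)
      show "?p d b \<in> carrier N" "?p e b \<in> carrier N" using g.hom_closed dF by auto
    qed
    have s: "(\<Sum>b\<in>B. frag_of (?p (d - e) b, b) - frag_of (?p d b, b) + frag_of (?p e b, b)) \<in> K"
      using pd pc B diffl by (intro Ksum) simp
    have "(d - e) - (\<Sum>b\<in>B. frag_of (?p (d - e) b, b)) \<in> K"
      using Kdiff[OF Kdiff[OF conjunct2[OF IHd] conjunct2[OF IHe]] s]
      by (simp add: sum.distrib sum_subtractf algebra_simps)
    then show "Poly_Mapping.keys (d - e) \<subseteq> carrier N \<times> P \<and>
      d - e - (\<Sum>b\<in>B. frag_of (?p (d - e) b, b)) \<in> K"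
      using de keys_diff[of d e] by auto
  next
    fix p assume "p \<in> carrier N \<times> P"
    then obtain n m where p: "p = (n, m)" and n: "n \<in> carrier N" and m: "m \<in> P" by auto
    have mM: "m \<in> carrier M" and exp: "m = (\<Oplus>\<^bsub>M\<^esub>b\<in>B. f b m \<odot>\<^bsub>M\<^esub> b)" using m PB by (auto simp: span_of_def)
    have 1: "frag_of (n, m) - (\<Sum>b\<in>B. frag_of (n, f b m \<odot>\<^bsub>M\<^esub> b)) \<in> K"
      using sumr[OF n fin, of "\<lambda>b. f b m \<odot>\<^bsub>M\<^esub> b"] exp fd B mM by auto
    have 2: "(\<Sum>b\<in>B. frag_of (f b m \<odot>\<^bsub>N\<^esub> n, b) - frag_of (n, f b m \<odot>\<^bsub>M\<^esub> b)) \<in> K"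
      using fd B mM n by (intro Ksum sm) auto
    have "(\<Sum>b\<in>B. frag_of (pre_tensor_map R N M (frag_of p) (f b), b)) = (\<Sum>b\<in>B. frag_of (f b m \<odot>\<^bsub>N\<^esub> n, b))"
      using fd by (intro sum.cong) (simp_all add: p pre_tensor_map_frag_of[OF N n mM])
    then show "Poly_Mapping.keys (frag_of p) \<subseteq> carrier N \<times> P \<and>
      frag_of p - (\<Sum>b\<in>B. frag_of (pre_tensor_map R N M (frag_of p) (f b), b)) \<in> K"
      using Kdiff[OF 1 2] n m by (simp add: p sum_subtractf)
  qed
  then have 1: "c - (\<Sum>b\<in>B. frag_of (pre_tensor_map R N M c (f b), b)) \<in> K" by simp
  have "(\<Sum>b\<in>B. frag_of (pre_tensor_map R N M c (f b), b)) \<in> K"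
    using ker[OF fd] zl B by (intro Ksum) simp
  from Kadd[OF 1 this] show ?thesis by (simp add: K_def)
qed

lemma Mittag_Leffler_of_limit:
  assumes L: "limit_of_finite_free_direct_summands R M"
  shows "flat_strict_Mittag_Leffler TYPE('n) R M"
  unfolding flat_strict_Mittag_Leffler_def
proof (intro allI impI inj_onI)
  fix N :: "('r, 'n) module" and C D
  assume N: "right_module R N" and C: "C \<in> carrier (tensor R N M)" and D: "D \<in> carrier (tensor R N M)"
    and eq: "tensor_map R N M C = tensor_map R N M D"
  interpret N: right_module R N by fact
  let ?F = "tensor_free N M"
  define K where "K = generate ?F (tensor_rels R N M)"
  interpret F: comm_group ?F by (rule abelian_free_Abelian_group)
  have K: "subgroup K ?F"
    unfolding K_def by (rule F.generate_is_subgroup[OF tensor_rels_subset[OF N left_module_axioms]])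
  obtain c d where c: "c \<in> carrier ?F" "C = K #>\<^bsub>?F\<^esub> c" and d: "d \<in> carrier ?F" "D = K #>\<^bsub>?F\<^esub> d"
    using C D by (auto simp: tensor_def carrier_FactGroup K_def simp del: carrier_free_Abelian_group_iff)
  have md: "- d \<in> carrier ?F" using d by simp
  have peq: "pre_tensor_map R N M c = pre_tensor_map R N M d"
    using eq c d tensor_map_coset[OF N left_module_axioms] by (simp add: K_def del: carrier_free_Abelian_group_iff)
  have cd: "c - d \<in> carrier ?F" using F.m_closed[OF c(1) md] by (simp del: carrier_free_Abelian_group_iff)
  have "c - d \<in> K"
    unfolding K_def
  proof (rule tensor_relation_of_kernel[OF N L cd])
    fix w assume w: "w \<in> carrier (dual R M)"
    interpret g: group_hom ?F "add_monoid N" "\<lambda>c. pre_tensor_map R N M c w"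
      using pre_tensor_map_hom_pointwise[OF N left_module_axioms w] N.N.a_group
      by (simp add: group_hom_def group_hom_axioms_def)
    have "pre_tensor_map R N M (c + - d) w = pre_tensor_map R N M c w \<oplus>\<^bsub>N\<^esub> pre_tensor_map R N M (- d) w"
      using g.hom_mult[OF c(1) md] by simp
    moreover have "pre_tensor_map R N M (- d) w = \<ominus>\<^bsub>N\<^esub> pre_tensor_map R N M d w"
      using g.hom_inv[OF d(1)] d(1) by (simp add: a_inv_def)
    moreover have "pre_tensor_map R N M d w \<in> carrier N" using g.hom_closed[OF d(1)] by simp
    ultimately show "pre_tensor_map R N M (c - d) w = \<zero>\<^bsub>N\<^esub>" using peq by (simp add: N.N.r_neg)
  qed
  then have "c \<in> D"
    unfolding d(2) r_coset_def by (auto intro!: bexI[of _ "c - d"])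
  then show "C = D" using F.repr_independence[OF _ d(1) K] c(2) d(2) by simp
qed

end

theorem proposition5p13:
  fixes R :: "('r, 'k) ring_scheme" and M :: "('r, 'm, 'l) module_scheme"
  assumes "local_ring R" and "left_module R M"
  shows "(flat_strict_Mittag_Leffler TYPE((nat \<Rightarrow> 'r) set) R M
            \<longleftrightarrow> limit_of_finite_free_direct_summands R M)
       \<and> (limit_of_finite_free_direct_summands R M \<longrightarrow> flat_strict_Mittag_Leffler TYPE('n) R M)"
proof -
  interpret left_module R M by fact
  show ?thesis
  proof (intro conjI iffI impI)
    assume "flat_strict_Mittag_Leffler TYPE((nat \<Rightarrow> 'r) set) R M"
    from finite_rank_fixes_of_Mittag_Leffler[OF this]
    show "limit_of_finite_free_direct_summands R M"
      by (rule limit_of_finite_free_direct_summandsI[OF assms(1)])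
  qed (simp_all add: Mittag_Leffler_of_limit)
qed

end
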